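(* Let $f=(f_1,\ldots,f_m)\colon\mathbb{R}^n\to\mathbb{R}^m$ be a locally Lipschitz mapping and let $\Omega\subset\mathbb{R}^n$ be a nonempty closed set. Assume that there exists $\bar y\in f(\Omega)$ such that the section $[f(\Omega)]_{\bar y}$ is bounded. Then the following statements are equivalent: (i) $f|_{\Omega}$ is proper at the sublevel $\bar y$. (ii) $f|_{\Omega}$ satisfies the Palais--Smale condition at $\bar y$, i.e., $\widetilde{K}_{\infty,\leqq\bar y}(f,\Omega)=\emptyset$. (iii) $f|_{\Omega}$ satisfies the weak Palais--Smale condition at $\bar y$, i.e., $K_{\infty,\leqq\bar y}(f,\Omega)=\emptyset$. (iv) $f|_{\Omega}$ is $M$-tame at the sublevel $\bar y$, i.e., $T_{\infty,\leqq\bar y}(f,\Omega)=\emptyset$. Furthermore, the set $[f(\Omega)]_{\bar y}$ is nonempty and compact provided that one of the equivalent conditions (i)--(iv) is satisfied.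
   Context: $\mathbb{R}^n$ carries the usual scalar product $\langle\cdot,\cdot\rangle$ and Euclidean norm $\|\cdot\|$. $\mathbb{R}^m_+$ is the set of vectors in $\mathbb{R}^m$ with all components $\ge 0$. For $a,b\in\mathbb{R}^m$, $a\leqq b$ means $b-a\in\mathbb{R}^m_+$. Section: for $A\subset\mathbb{R}^m$ and $y\in\mathbb{R}^m$, $[A]_y:=A\cap(y-\mathbb{R}^m_+)$ is the section of $A$ at $y$. It is bounded if there is $a\in\mathbb{R}^m$ with $[A]_y\subset a+\mathbb{R}^m_+$. Properness: $f|_\Omega$ is proper at sublevel $y\in\mathbb{R}^m$ if for every sequence $\{x^k\}\subset\Omega$ with $\|x^k\|\to\infty$ and $f(x^k)\leqq y$ for all $k$, one has $\|f(x^k)\|\to\infty$ as $k\to\infty$. Normal cones and subdifferential: for $\Omega\subset\mathbb{R}^n$ and $\bar x\in\Omega$, the regular normal cone $\widehat N(\bar x;\Omega)$ consists of all $v\in\mathbb{R}^n$ with $\langle v,x-\bar x\rangle\le o(\|x-\bar x\|)$ as $x\to\bar x$, $x\in\Omega$. The limiting normal cone $N(\bar x;\Omega)$ consists of all $v$ for which there are sequences $x^k\to\bar x$ with $x^k\in\Omega$ and $v^k\to v$ with $v^k\in\widehat N(x^k;\Omega)$. For $\phi\colon\mathbb{R}^n\to\mathbb{R}$, the limiting subdifferential is $\partial\phi(\bar x):=\{v\in\mathbb{R}^n \mid (v,-1)\in N((\bar x,\phi(\bar x));\mathrm{epi}\,\phi)\}$, where $\mathrm{epi}\,\phi=\{(x,y)\in\mathbb{R}^n\times\mathbb{R}\mid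 \phi(x)\le y\}$. Rabier function: $$\nu(x):=\inf\Big\{\Big\|\sum_{i=1}^m\lambda_i v^i+w\Big\| \;\Big|\; v^i\in\partial f_i(x)\cup\partial(-f_i)(x),\ w\in N(x;\Omega),\ \lambda\in\mathbb{R}^m_+,\ \sum_{i=1}^m\lambda_i=1\Big\}.$$ The set $\Gamma(f,\Omega)$ consists of all $x\in\Omega$ for which there exist $v^i\in\partial f_i(x)\cup\partial(-f_i)(x)$, $i=1,\ldots,m$, and $(\lambda,\mu)\in\mathbb{R}^m_+\times\mathbb{R}$ with $\sum_{i=1}^m\lambda_i+|\mu|=1$ such that $0\in\sum_{i=1}^m\lambda_i v^i+\mu x+N(x;\Omega)$. For $\bar y\in\mathbb{R}^m$: - $\widetilde K_{\infty,\leqq\bar y}(f,\Omega)$ is the set of $y\in\mathbb{R}^m$ for which there is a sequence $\{x^k\}\subset\Omega$ with $f(x^k)\leqq\bar y$ for all $k$, $\|x^k\|\to\infty$, $f(x^k)\to y$, and $\nu(x^k)\to 0$. - $K_{\infty,\leqq\bar y}(f,\Omega)$ is the set of $y\in\mathbb{R}^m$ for which there is a sequence $\{x^k\}\subset\Omega$ with $f(x^k)\leqq\bar y$ for all $k$, $\|x^k\|\to\infty$, $f(x^k)\to y$, and $\|x^k\|\nu(x^k)\to 0$. - $T_{\infty,\leqq\bar y}(f,\Omega)$ is the set of $y\in\mathbb{R}^m$ for which there is a sequence $\{x^k\}\subset\Gamma(f,\Omega)$ with $f(x^k)\leqq\bar y$ for all $k$, $\|x^k\|\to\infty$, and $f(x^k)\to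 y$. *)

theory Defs
  imports "HOL-Analysis.Analysis" "HOL-Library.Landau_Symbols"
begin

text \<open>
  The order on \<^typ>\<open>real ^ 'm\<close> is componentwise, so \<open>{0..}\<close> is the nonnegative orthant,
  \<open>{..y}\<close> is y minus the orthant and \<open>{a..}\<close> is a plus the orthant.
\<close>

definition lower_section :: "(real ^ 'm) set \<Rightarrow> real ^ 'm \<Rightarrow> (real ^ 'm) set" where
  "lower_section A y = A \<inter> {..y}"

definition bounded_section :: "(real ^ 'm) set \<Rightarrow> real ^ 'm \<Rightarrow> bool" where
  "bounded_section A y \<longleftrightarrow> (\<exists>a. lower_section A y \<subseteq> {a..})"

definition locally_lipschitz :: "('a::metric_space \<Rightarrow> 'b::metric_space) \<Rightarrow> bool" where
  "locally_lipschitz f \<longleftrightarrow> (\<forall>x. \<exists>r>0. \<exists>L. L-lipschitz_on (ball x r) f)"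

definition proper_at_sublevel ::
    "(real ^ 'n \<Rightarrow> real ^ 'm) \<Rightarrow> (real ^ 'n) set \<Rightarrow> real ^ 'm \<Rightarrow> bool" where
  "proper_at_sublevel f \<Omega> y \<longleftrightarrow>
     (\<forall>x :: nat \<Rightarrow> real ^ 'n.
        (\<forall>k. x k \<in> \<Omega>) \<and> filterlim (\<lambda>k. norm (x k)) at_top sequentially \<and> (\<forall>k. f (x k) \<le> y)
        \<longrightarrow> filterlim (\<lambda>k. norm (f (x k))) at_top sequentially)"

text \<open>Both normal cones are only meaningful at points of the set.\<close>

definition regular_normal_cone :: "'a::euclidean_space \<Rightarrow> 'a set \<Rightarrow> 'a set" where
  "regular_normal_cone xbar \<Omega> =
     {v. \<exists>r \<in> o[at xbar within \<Omega>](\<lambda>x. norm (x - xbar)).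
           \<forall>\<^sub>F x in at xbar within \<Omega>. inner v (x - xbar) \<le> r x}"

definition limiting_normal_cone :: "'a::euclidean_space \<Rightarrow> 'a set \<Rightarrow> 'a set" where
  "limiting_normal_cone xbar \<Omega> =
     {v. \<exists>(x :: nat \<Rightarrow> 'a) (u :: nat \<Rightarrow> 'a).
           x \<longlonglongrightarrow> xbar \<and> (\<forall>k. x k \<in> \<Omega>) \<and>
           u \<longlonglongrightarrow> v \<and> (\<forall>k. u k \<in> regular_normal_cone (x k) \<Omega>)}"

definition limiting_subdifferential ::
    "('a::euclidean_space \<Rightarrow> real) \<Rightarrow> 'a \<Rightarrow> 'a set" where
  "limiting_subdifferential \<phi> xbar =
     {v. (v, -1) \<in> limiting_normal_cone (xbar, \<phi> xbar) (epigraph UNIV \<phi>)}"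

definition symmetric_subdifferential ::
    "('a::euclidean_space \<Rightarrow> real) \<Rightarrow> 'a \<Rightarrow> 'a set" where
  "symmetric_subdifferential \<phi> x =
     limiting_subdifferential \<phi> x \<union> limiting_subdifferential (\<lambda>z. - \<phi> z) x"

text \<open>
  The infimum is taken in \<^typ>\<open>real\<close>: for locally Lipschitz f and x in the set, the limiting
  subdifferentials are nonempty and 0 is normal, so it ranges over a nonempty set bounded below by 0.
\<close>

definition rabier :: "(real ^ 'n \<Rightarrow> real ^ 'm) \<Rightarrow> (real ^ 'n) set \<Rightarrow> real ^ 'n \<Rightarrow> real" where
  "rabier f \<Omega> x =
     Inf {norm ((\<Sum>i\<in>UNIV. (l $ i) *\<^sub>R v i) + w) | (v :: 'm \<Rightarrow> real ^ 'n) w (l :: real ^ 'm).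
            (\<forall>i. v i \<in> symmetric_subdifferential (\<lambda>z. f z $ i) x) \<and>
            w \<in> limiting_normal_cone x \<Omega> \<and>
            l \<in> {0..} \<and> (\<Sum>i\<in>UNIV. l $ i) = 1}"

definition Gamma_set :: "(real ^ 'n \<Rightarrow> real ^ 'm) \<Rightarrow> (real ^ 'n) set \<Rightarrow> (real ^ 'n) set" where
  "Gamma_set f \<Omega> =
     {x \<in> \<Omega>. \<exists>(v :: 'm \<Rightarrow> real ^ 'n) (l :: real ^ 'm) (\<mu> :: real).
        (\<forall>i. v i \<in> symmetric_subdifferential (\<lambda>z. f z $ i) x) \<and>
        l \<in> {0..} \<and> (\<Sum>i\<in>UNIV. l $ i) + \<bar>\<mu>\<bar> = 1 \<and>
        (\<exists>w \<in> limiting_normal_cone x \<Omega>.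
           0 = (\<Sum>i\<in>UNIV. (l $ i) *\<^sub>R v i) + \<mu> *\<^sub>R x + w)}"

definition Ktilde_inf ::
    "(real ^ 'n \<Rightarrow> real ^ 'm) \<Rightarrow> (real ^ 'n) set \<Rightarrow> real ^ 'm \<Rightarrow> (real ^ 'm) set" where
  "Ktilde_inf f \<Omega> ybar =
     {y. \<exists>x :: nat \<Rightarrow> real ^ 'n.
        (\<forall>k. x k \<in> \<Omega>) \<and> (\<forall>k. f (x k) \<le> ybar) \<and>
        filterlim (\<lambda>k. norm (x k)) at_top sequentially \<and>
        (\<lambda>k. f (x k)) \<longlonglongrightarrow> y \<and>
        (\<lambda>k. rabier f \<Omega> (x k)) \<longlonglongrightarrow> 0}"

definition K_inf ::
    "(real ^ 'n \<Rightarrow> real ^ 'm) \<Rightarrow> (real ^ 'n) set \<Rightarrow> real ^ 'm \<Rightarrow> (real ^ 'm) set" where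
  "K_inf f \<Omega> ybar =
     {y. \<exists>x :: nat \<Rightarrow> real ^ 'n.
        (\<forall>k. x k \<in> \<Omega>) \<and> (\<forall>k. f (x k) \<le> ybar) \<and>
        filterlim (\<lambda>k. norm (x k)) at_top sequentially \<and>
        (\<lambda>k. f (x k)) \<longlonglongrightarrow> y \<and>
        (\<lambda>k. norm (x k) * rabier f \<Omega> (x k)) \<longlonglongrightarrow> 0}"

definition T_inf ::
    "(real ^ 'n \<Rightarrow> real ^ 'm) \<Rightarrow> (real ^ 'n) set \<Rightarrow> real ^ 'm \<Rightarrow> (real ^ 'm) set" where
  "T_inf f \<Omega> ybar =
     {y. \<exists>x :: nat \<Rightarrow> real ^ 'n.
        (\<forall>k. x k \<in> Gamma_set f \<Omega>) \<and> (\<forall>k. f (x k) \<le> ybar) \<and>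
        filterlim (\<lambda>k. norm (x k)) at_top sequentially \<and>
        (\<lambda>k. f (x k)) \<longlonglongrightarrow> y}"

definition palais_smale ::
    "(real ^ 'n \<Rightarrow> real ^ 'm) \<Rightarrow> (real ^ 'n) set \<Rightarrow> real ^ 'm \<Rightarrow> bool" where
  "palais_smale f \<Omega> ybar \<longleftrightarrow> Ktilde_inf f \<Omega> ybar = {}"

definition weak_palais_smale ::
    "(real ^ 'n \<Rightarrow> real ^ 'm) \<Rightarrow> (real ^ 'n) set \<Rightarrow> real ^ 'm \<Rightarrow> bool" where
  "weak_palais_smale f \<Omega> ybar \<longleftrightarrow> K_inf f \<Omega> ybar = {}"

definition M_tame ::
    "(real ^ 'n \<Rightarrow> real ^ 'm) \<Rightarrow> (real ^ 'n) set \<Rightarrow> real ^ 'm \<Rightarrow> bool" where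
  "M_tame f \<Omega> ybar \<longleftrightarrow> T_inf f \<Omega> ybar = {}"

end

theory Submission
  imports Defs
begin

text \<open>
  Boundedness of the section makes properness at \<open>ybar\<close> equivalent to boundedness of
  \<open>{x \<in> \<Omega>. f x \<le> ybar}\<close>, which leaves no sequences for the other three conditions.
  This set is the part of \<open>\<Omega>\<close> where \<open>\<psi> = max\<^sub>i (f\<^sub>i - ybar\<^sub>i)\<close> is nonpositive, and \<open>\<psi>\<close> is bounded
  below on it. If it is unbounded, minimize \<open>\<psi>\<close>: over \<open>\<Omega>\<close> intersected with large spheres this yields points
  of \<open>\<Gamma>(f, \<Omega>)\<close>. Adding \<open>5 \<delta> (norm (x - p) / norm p)\<^sup>2\<close> and minimizing over \<open>\<Omega>\<close> and the ball
  of radius \<open>norm p / 2\<close> around a point \<open>p\<close> at which \<open>\<psi>\<close> is within \<open>\<delta>\<close> of its infimum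
  near infinity forces an interior minimizer \<open>x\<close> with \<open>norm x * \<nu> x \<le> 15 \<delta> / 2\<close>; no variational
  principle is needed. The multiplier rule behind both steps comes from quadratic penalties that
  decouple the epigraphs of the components from \<open>\<Omega>\<close>.
\<close>

section \<open>Normal cones\<close>

text \<open>The positive part of \<open>inner v (y - x)\<close> is the least nonnegative candidate
  for the little-o majorant, so the existential over \<open>r\<close> becomes an epsilon
  inequality.\<close>

lemma regular_normal_cone_iff:
  "v \<in> regular_normal_cone x S \<longleftrightarrow>
     (\<forall>e>0. \<forall>\<^sub>F y in at x within S. inner v (y - x) \<le> e * norm (y - x))"
proof
  assume "v \<in> regular_normal_cone x S"
  then obtain r where r: "r \<in> o[at x within S](\<lambda>y. norm (y - x))"
    "\<forall>\<^sub>F y in at x within S. inner v (y - x) \<le> r y"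
    by (auto simp: regular_normal_cone_def)
  show "\<forall>e>0. \<forall>\<^sub>F y in at x within S. inner v (y - x) \<le> e * norm (y - x)"
  proof (intro allI impI)
    fix e :: real assume "e > 0"
    from landau_o.smallD[OF r(1) this] r(2)
    show "\<forall>\<^sub>F y in at x within S. inner v (y - x) \<le> e * norm (y - x)"
      by eventually_elim auto
  qed
next
  assume *: "\<forall>e>0. \<forall>\<^sub>F y in at x within S. inner v (y - x) \<le> e * norm (y - x)"
  have "(\<lambda>y. max 0 (inner v (y - x))) \<in> o[at x within S](\<lambda>y. norm (y - x))"
  proof (rule landau_o.smallI)
    fix e :: real assume "e > 0"
    with * have "\<forall>\<^sub>F y in at x within S. inner v (y - x) \<le> e * norm (y - x)" by blast
    then show "\<forall>\<^sub>F y in at x within S.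
        norm (max 0 (inner v (y - x))) \<le> e * norm (norm (y - x))"
      by eventually_elim (use \<open>e > 0\<close> in auto)
  qed
  then show "v \<in> regular_normal_cone x S"
    unfolding regular_normal_cone_def
    by (intro CollectI bexI[where x = "\<lambda>y. max 0 (inner v (y - x))"]) auto
qed

lemma regular_normal_cone_scaleR:
  assumes "v \<in> regular_normal_cone x S" "c > 0"
  shows "c *\<^sub>R v \<in> regular_normal_cone x S"
  unfolding regular_normal_cone_iff
proof (intro allI impI)
  fix e :: real assume "e > 0"
  then have "e / c > 0" using assms by simp
  then have "\<forall>\<^sub>F y in at x within S. inner v (y - x) \<le> (e / c) * norm (y - x)"
    using assms unfolding regular_normal_cone_iff by blast
  then show "\<forall>\<^sub>F y in at x within S. inner (c *\<^sub>R v) (y - x) \<le> e * norm (y - x)"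
    by eventually_elim (use \<open>c > 0\<close> in \<open>simp add: field_simps\<close>)
qed

lemma limiting_normal_cone_scaleR:
  assumes "v \<in> limiting_normal_cone x S" "c > 0"
  shows "c *\<^sub>R v \<in> limiting_normal_cone x S"
proof -
  obtain X u where "X \<longlonglongrightarrow> x" "\<And>k. X k \<in> S" "u \<longlonglongrightarrow> v"
    "\<And>k. u k \<in> regular_normal_cone (X k) S"
    using assms by (auto simp: limiting_normal_cone_def)
  then show ?thesis
    unfolding limiting_normal_cone_def using assms(2)
    by (intro CollectI exI[of _ X] exI[of _ "\<lambda>k. c *\<^sub>R u k"] conjI allI)
       (simp_all add: tendsto_scaleR regular_normal_cone_scaleR)
qed

lemma square_norm_derivative:
  "((\<lambda>y. (norm (y - p))\<^sup>2) has_derivative (\<lambda>h. inner (2 *\<^sub>R (x - p)) h)) (at x within S)"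
  for p x :: "'a::real_inner"
  unfolding power2_norm_eq_inner
  by (auto intro!: derivative_eq_intros simp: inner_commute algebra_simps)

text \<open>Fermat's rule: minimality makes the increment of \<open>F\<close> nonnegative, and
  differentiability equates it with \<open>inner g (y - x)\<close> up to an arbitrarily small
  multiple of \<open>norm (y - x)\<close>.\<close>

lemma regular_normal_cone_minimizer:
  assumes der: "(F has_derivative (\<lambda>h. inner g h)) (at x within S)"
    and min: "\<forall>\<^sub>F y in at x within S. F x \<le> F y"
  shows "- g \<in> regular_normal_cone x S"
  unfolding regular_normal_cone_iff
proof (intro allI impI)
  fix e :: real assume "e > 0"
  then obtain d where d: "d > 0"
    "\<And>y. y \<in> S \<Longrightarrow> norm (y - x) < d \<Longrightarrow> norm (F y - F x - inner g (y - x)) \<le> e * norm (y - x)"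
    using der unfolding has_derivative_within_alt by blast
  then have "\<forall>\<^sub>F y in at x within S. norm (F y - F x - inner g (y - x)) \<le> e * norm (y - x)"
    unfolding eventually_at by (intro exI[of _ d]) (auto simp: dist_norm)
  with min show "\<forall>\<^sub>F y in at x within S. inner (- g) (y - x) \<le> e * norm (y - x)"
    by eventually_elim (auto simp: abs_le_iff)
qed

text \<open>Along a feasible ray both sides of the defining inequality scale with \<open>t\<close>;
  cancelling it leaves only an arbitrarily small multiple of \<open>norm d\<close>.\<close>

lemma regular_normal_cone_direction:
  assumes v: "v \<in> regular_normal_cone x S" and "r > 0"
    and feas: "\<And>t. 0 < t \<Longrightarrow> t < r \<Longrightarrow> x + t *\<^sub>R d \<in> S"
  shows "inner v d \<le> 0"
proof (cases "d = 0")
  case False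
  have *: "inner v d \<le> e * norm d" if "e > 0" for e
  proof -
    obtain c where c: "c > 0"
      "\<And>y. y \<in> S \<Longrightarrow> y \<noteq> x \<Longrightarrow> dist y x < c \<Longrightarrow> inner v (y - x) \<le> e * norm (y - x)"
      using v \<open>e > 0\<close> unfolding regular_normal_cone_iff eventually_at by blast
    \<comment> \<open>Small enough for feasibility and for the point to lie within \<open>c\<close>
      of \<open>x\<close>.\<close>
    define t where "t = min (r / 2) (c / (2 * norm d))"
    have t: "0 < t" "t < r" using \<open>r > 0\<close> c(1) False by (auto simp: t_def)
    have "t * norm d \<le> (c / (2 * norm d)) * norm d"
      by (intro mult_right_mono) (auto simp: t_def)
    also have "\<dots> < c" using c(1) False by simp
    finally have "dist (x + t *\<^sub>R d) x < c" using t by (simp add: dist_norm)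
    from c(2)[OF feas[OF t] _ this] t False
    have "t * inner v d \<le> t * (e * norm d)" by (simp add: algebra_simps)
    with t show ?thesis by simp
  qed
  then have "inner v d \<le> 0 + e" if "e > 0" for e
    using *[of "e / norm d"] that False by simp
  then show ?thesis by (rule field_le_epsilon)
qed simp

text \<open>The second factor is unconstrained, so \<open>(0, snd v)\<close> is itself a feasible
  direction and testing \<open>v\<close> along it gives a nonpositive square. The first component is
  tested on the slice with second entry \<open>s\<close>.\<close>

lemma regular_normal_cone_Times_UNIV:
  fixes v :: "'a::euclidean_space \<times> 'b::euclidean_space"
  assumes v: "v \<in> regular_normal_cone (x, s) (S \<times> UNIV)" and x: "x \<in> S"
  shows "fst v \<in> regular_normal_cone x S" and "snd v = 0"
proof -
  have "inner v (0, snd v) \<le> 0"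
    by (rule regular_normal_cone_direction[OF v zero_less_one]) (simp add: x)
  then have "inner (snd v) (snd v) = 0"
    using inner_ge_zero[of "snd v"] by (simp add: inner_prod_def)
  then show "snd v = 0" by simp
  show "fst v \<in> regular_normal_cone x S"
    unfolding regular_normal_cone_iff
  proof (intro allI impI)
    fix e :: real assume "e > 0"
    have "filterlim (\<lambda>y. (y, s)) (at (x, s) within S \<times> UNIV) (at x within S)"
      unfolding filterlim_at by (auto intro!: tendsto_Pair simp: eventually_at_filter)
    moreover have "\<forall>\<^sub>F y in at (x, s) within S \<times> UNIV.
        inner v (y - (x, s)) \<le> e * norm (y - (x, s))"
      using v \<open>e > 0\<close> by (simp add: regular_normal_cone_iff)
    ultimately have "\<forall>\<^sub>F y in at x within S.
        inner v ((y, s) - (x, s)) \<le> e * norm ((y, s) - (x, s))"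
      unfolding filterlim_iff by blast
    then show "\<forall>\<^sub>F y in at x within S. inner (fst v) (y - x) \<le> e * norm (y - x)"
      by (simp add: inner_prod_def norm_Pair)
  qed
qed

text \<open>Each conclusion tests the normal along one feasible direction: \<open>(0, 1)\<close> for
  the sign of \<open>l\<close>; \<open>(p, L * norm p)\<close>, which the Lipschitz bound keeps
  inside the epigraph, for the slope; \<open>(0, - 1)\<close>, feasible strictly above the graph,
  for the last one.\<close>

lemma epigraph_normal:
  fixes \<phi> :: "'a::euclidean_space \<Rightarrow> real"
  assumes z: "(p, - l) \<in> regular_normal_cone (u, t) (epigraph UNIV \<phi>)"
    and ut: "\<phi> u \<le> t" and lip: "L-lipschitz_on (ball x r) \<phi>" and u: "u \<in> ball x r"
  shows "l \<ge> 0" and "norm p \<le> L * l" and "l > 0 \<Longrightarrow> t = \<phi> u"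
proof -
  have "inner (p, - l) (0, 1) \<le> 0"
    by (rule regular_normal_cone_direction[OF z, of 1]) (use ut in \<open>auto simp: epigraph_def\<close>)
  then show "l \<ge> 0" by simp
  have "L \<ge> 0" using lip by (rule lipschitz_on_nonneg)
  show "norm p \<le> L * l"
  proof (cases "p = 0")
    case False
    \<comment> \<open>For steps shorter than \<open>e\<close> the move along \<open>p\<close> stays
      in the ball where \<phi> is Lipschitz.\<close>
    define e where "e = (r - dist x u) / norm p"
    have e: "e > 0" using u False by (simp add: e_def)
    have "inner (p, - l) (p, L * norm p) \<le> 0"
    proof (rule regular_normal_cone_direction[OF z e])
      fix c assume c: "0 < c" "c < e"
      then have "dist u (u + c *\<^sub>R p) < r - dist x u"
        using False by (simp add: e_def field_simps dist_norm)
      then have "u + c *\<^sub>R p \<in> ball x r"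
        using dist_triangle[of x "u + c *\<^sub>R p" u] by simp
      from lipschitz_onD[OF lip this u] c
      show "(u, t) + c *\<^sub>R (p, L * norm p) \<in> epigraph UNIV \<phi>"
        using ut by (simp add: epigraph_def dist_norm abs_le_iff algebra_simps)
    qed
    then have "norm p * norm p \<le> (L * l) * norm p"
      by (simp add: power2_eq_square flip: power2_norm_eq_inner) (simp add: algebra_simps)
    with False show ?thesis by simp
  qed (use \<open>l \<ge> 0\<close> \<open>L \<ge> 0\<close> in simp)
  show "t = \<phi> u" if "l > 0"
  proof (rule ccontr)
    assume "t \<noteq> \<phi> u"
    with ut have "t - \<phi> u > 0" by simp
    then have "inner (p, - l) (0, - 1) \<le> 0"
      by (rule regular_normal_cone_direction[OF z]) (auto simp: epigraph_def)
    with that show False by simp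
  qed
qed

section \<open>Multiplier rules by penalization\<close>

text \<open>Every set \<open>C i\<close> gets its own copy \<open>P i\<close> of the variable
  \<open>Q\<close>; only the penalty of weight \<open>k\<close> ties the copies together and
  enforces \<open>H = 0\<close>. As \<open>k\<close> grows, compactness makes the copies agree in a
  limit that is feasible, and the term \<open>(norm (Q - q))\<^sup>2\<close> makes \<open>q\<close>
  the only possible limit.\<close>

lemma penalty_minimizers_near:
  fixes C :: "'i::finite \<Rightarrow> 'a::euclidean_space set"
  assumes C: "\<And>i. closed (C i)" "\<And>i. q \<in> C i" and D: "closed D" "q \<in> D" and \<rho>: "\<rho> > 0"
    and \<Phi>: "continuous_on UNIV \<Phi>" and H: "continuous_on UNIV H" "H q = 0"
    and min: "\<forall>x \<in> D \<inter> (\<Inter>i. C i) \<inter> cball q \<rho>. H x = 0 \<longrightarrow> \<Phi> q \<le> \<Phi> x"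
    and \<epsilon>: "\<epsilon> > 0"
  defines "F \<equiv> \<lambda>k Q (P :: 'i \<Rightarrow> 'a). \<Phi> Q + (norm (Q - q))\<^sup>2 +
             k * ((\<Sum>i\<in>UNIV. (norm (Q - P i))\<^sup>2) + (H Q)\<^sup>2)"
  obtains k :: real and Q P where "k \<ge> 0" "Q \<in> D" "dist Q q < \<epsilon>"
    "\<forall>i. P i \<in> C i \<and> dist (P i) q < \<epsilon>"
    "\<forall>Q'\<in>D \<inter> cball q \<rho>. \<forall>P'. (\<forall>i. P' i \<in> C i \<inter> cball q \<rho>) \<longrightarrow> F k Q P \<le> F k Q' P'"
proof -
  \<comment> \<open>The copies are packed into one vector, so that the joint constraint set is
    compact.\<close>
  define K where "K = (D \<inter> cball q \<rho>) \<times> {P :: 'a ^ 'i. \<forall>i. P $ i \<in> C i \<inter> cball q \<rho>}"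
  have "closed {P :: 'a ^ 'i. \<forall>i. P $ i \<in> C i \<inter> cball q \<rho>}"
    by (rule closed_vector_box) (use C in auto)
  moreover have "bounded {P :: 'a ^ 'i. \<forall>i. P $ i \<in> C i \<inter> cball q \<rho>}"
  proof (rule boundedI)
    fix P :: "'a ^ 'i" assume P: "P \<in> {P. \<forall>i. P $ i \<in> C i \<inter> cball q \<rho>}"
    have "norm (P $ i) \<le> norm q + \<rho>" for i
    proof -
      have "dist q (P $ i) \<le> \<rho>" using P by auto
      then show ?thesis
        using norm_triangle_ineq2[of "P $ i" q] by (simp add: dist_norm norm_minus_commute)
    qed
    then have "(\<Sum>i\<in>UNIV. norm (P $ i)) \<le> (\<Sum>i\<in>(UNIV::'i set). norm q + \<rho>)"
      by (intro sum_mono)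
    moreover have "norm P \<le> (\<Sum>i\<in>UNIV. norm (P $ i))"
      unfolding norm_vec_def by (rule L2_set_le_sum) simp
    ultimately show "norm P \<le> (\<Sum>i\<in>(UNIV::'i set). norm q + \<rho>)" by linarith
  qed
  ultimately have cK: "compact K"
    unfolding K_def using D by (intro compact_Times closed_Int_compact) (auto simp: compact_eq_bounded_closed)
  have qK: "(q, \<chi> i. q) \<in> K" using C D \<rho> by (simp add: K_def)
  define pen where "pen = (\<lambda>X :: 'a \<times> ('a ^ 'i).
    (\<Sum>i\<in>UNIV. (norm (fst X - snd X $ i))\<^sup>2) + (H (fst X))\<^sup>2)"
  have \<Phi>c: "continuous_on UNIV (\<lambda>X :: 'a \<times> ('a ^ 'i). \<Phi> (fst X))"
    by (rule continuous_on_compose2[OF \<Phi>]) (auto intro: continuous_intros)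
  have "continuous_on UNIV (\<lambda>X :: 'a \<times> ('a ^ 'i). H (fst X))"
    by (rule continuous_on_compose2[OF H(1)]) (auto intro: continuous_intros)
  then have penc: "continuous_on UNIV pen"
    unfolding pen_def by (intro continuous_intros)
  have pen0: "pen X \<ge> 0" for X by (simp add: pen_def sum_nonneg)
  have F_eq: "F k (fst Y) (($) (snd Y)) = \<Phi> (fst Y) + (norm (fst Y - q))\<^sup>2 + k * pen Y" for k Y
    by (simp add: F_def pen_def)
  have "\<exists>X\<in>K. \<forall>Y\<in>K. F (real k) (fst X) (($) (snd X)) \<le> F (real k) (fst Y) (($) (snd Y))" for k
  proof (rule continuous_attains_inf[OF cK])
    show "continuous_on K (\<lambda>X. F (real k) (fst X) (($) (snd X)))"
      unfolding F_eq
      by (intro continuous_intros continuous_on_subset[OF \<Phi>c] continuous_on_subset[OF penc]) auto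
  qed (use qK in auto)
  then obtain X where X: "\<And>k. X k \<in> K"
    and Xmin: "\<And>k Y. Y \<in> K \<Longrightarrow>
      F (real k) (fst (X k)) (($) (snd (X k))) \<le> F (real k) (fst Y) (($) (snd Y))"
    by metis
  \<comment> \<open>Comparison with the point whose copies all equal \<open>q\<close>: its penalty
    and its quadratic term vanish.\<close>
  have Xle: "\<Phi> (fst (X k)) + (norm (fst (X k) - q))\<^sup>2 + real k * pen (X k) \<le> \<Phi> q" for k
    using Xmin[OF qK, of k] unfolding F_eq by (simp add: pen_def H)
  \<comment> \<open>Together with \<open>Xle\<close> this lower bound gives a penalty of at most
    \<open>(\<Phi> q - b) / k\<close>, which tends to 0.\<close>
  obtain b where b: "\<And>x. x \<in> cball q \<rho> \<Longrightarrow> b \<le> \<Phi> x"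
    using continuous_attains_inf[OF compact_cball, of q \<rho> \<Phi>] \<rho> continuous_on_subset[OF \<Phi>]
    by (metis cball_eq_empty not_less_iff_gr_or_eq top_greatest)
  obtain l r where l: "l \<in> K" and r: "strict_mono r" and lim: "(\<lambda>j. X (r j)) \<longlonglongrightarrow> l"
    using cK X unfolding compact_def o_def by meson
  have "(\<lambda>j. pen (X (r j))) \<longlonglongrightarrow> pen l"
    by (rule continuous_on_tendsto_compose[OF penc lim]) auto
  moreover have "(\<lambda>j. pen (X (r j))) \<longlonglongrightarrow> 0"
  proof (rule tendsto_sandwich[OF _ _ tendsto_const])
    have "pen (X (r j)) \<le> (\<Phi> q - b) * inverse (real (r j))" if "j > 0" for j
    proof -
      have rj: "real (r j) > 0" using that seq_suble[OF r, of j] by simp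
      have "real (r j) * pen (X (r j)) \<le> \<Phi> q - b"
      proof -
        have "b \<le> \<Phi> (fst (X (r j)))" using X[of "r j"] by (intro b) (auto simp: K_def)
        then show ?thesis
          using Xle[of "r j"] zero_le_power2[of "norm (fst (X (r j)) - q)"] by linarith
      qed
      with rj show ?thesis by (simp add: field_simps)
    qed
    then show "\<forall>\<^sub>F j in sequentially. pen (X (r j)) \<le> (\<Phi> q - b) * inverse (real (r j))"
      using eventually_gt_at_top by (rule eventually_mono[rotated])
    have "(\<lambda>j. inverse (real (r j))) \<longlonglongrightarrow> 0"
      using LIMSEQ_subseq_LIMSEQ[OF lim_inverse_n r] by (simp add: o_def)
    then show "(\<lambda>j. (\<Phi> q - b) * inverse (real (r j))) \<longlonglongrightarrow> 0"
      by (rule tendsto_mult_right_zero)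
  qed (use pen0 in auto)
  ultimately have "pen l = 0" by (rule LIMSEQ_unique)
  then have "(\<Sum>i\<in>UNIV. (norm (fst l - snd l $ i))\<^sup>2) = 0" and Hl: "H (fst l) = 0"
    unfolding pen_def by (auto simp: add_nonneg_eq_0_iff sum_nonneg)
  then have li: "snd l $ i = fst l" for i by (simp add: sum_nonneg_eq_0_iff)
  have "fst l \<in> C i" for i using l li[of i] unfolding K_def by (metis (mono_tags) Int_iff mem_Collect_eq mem_Times_iff)
  \<comment> \<open>The limit is feasible, so its value is no better than that of \<open>q\<close>;
    the limit of \<open>Xle\<close> then forces \<open>norm (fst l - q)\<close> to be 0.\<close>
  then have "\<Phi> q \<le> \<Phi> (fst l)"
    using min l Hl by (auto simp: K_def)
  moreover have "\<Phi> (fst l) + (norm (fst l - q))\<^sup>2 \<le> \<Phi> q"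
  proof (rule LIMSEQ_le_const2)
    show "(\<lambda>j. \<Phi> (fst (X (r j))) + (norm (fst (X (r j)) - q))\<^sup>2) \<longlonglongrightarrow>
        \<Phi> (fst l) + (norm (fst l - q))\<^sup>2"
      by (intro tendsto_intros continuous_on_tendsto_compose[OF \<Phi>c lim]) (auto intro!: lim)
    show "\<exists>N. \<forall>n\<ge>N. \<Phi> (fst (X (r n))) + (norm (fst (X (r n)) - q))\<^sup>2 \<le> \<Phi> q"
    proof (intro exI allI impI)
      fix n show "\<Phi> (fst (X (r n))) + (norm (fst (X (r n)) - q))\<^sup>2 \<le> \<Phi> q"
        using Xle[of "r n"] mult_nonneg_nonneg[OF of_nat_0_le_iff pen0, of "r n" "X (r n)"] by linarith
    qed
  qed
  ultimately have lq: "fst l = q"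
    using zero_le_power2[of "norm (fst l - q)"] by (simp add: order_antisym_conv)
  have "\<forall>\<^sub>F j in sequentially. dist (X (r j)) l < \<epsilon>"
    using lim \<epsilon> by (rule tendstoD)
  then obtain j where j: "dist (X (r j)) l < \<epsilon>"
    unfolding eventually_sequentially by blast
  show thesis
  proof (rule that[of "real (r j)" "fst (X (r j))" "($) (snd (X (r j)))"])
    show "dist (fst (X (r j))) q < \<epsilon>" using dist_fst_le[of "X (r j)" l] j lq by simp
    have "dist (snd (X (r j)) $ i) q < \<epsilon>" for i
      using dist_vec_nth_le[of "snd (X (r j))" i "snd l"] dist_snd_le[of "X (r j)" l] j li[of i] lq
      by simp
    then show "\<forall>i. snd (X (r j)) $ i \<in> C i \<and> dist (snd (X (r j)) $ i) q < \<epsilon>"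
      using X[of "r j"] by (auto simp: K_def)
    have "F (real (r j)) (fst (X (r j))) (($) (snd (X (r j)))) \<le> F (real (r j)) Q' P'"
      if "Q' \<in> D \<inter> cball q \<rho>" "\<forall>i. P' i \<in> C i \<inter> cball q \<rho>" for Q' P'
      using Xmin[of "(Q', \<chi> i. P' i)" "r j"] that by (simp add: K_def F_def)
    then show "\<forall>Q'\<in>D \<inter> cball q \<rho>. \<forall>P'. (\<forall>i. P' i \<in> C i \<inter> cball q \<rho>) \<longrightarrow>
        F (real (r j)) (fst (X (r j))) (($) (snd (X (r j)))) \<le> F (real (r j)) Q' P'"
      by blast
  qed (use X[of "r j"] in \<open>auto simp: K_def\<close>)
qed

text \<open>Letting \<open>\<epsilon>\<close> tend to 0 turns these points into multipliers in the limiting sense.\<close>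

lemma approximate_multipliers:
  fixes C :: "'i::finite \<Rightarrow> 'a::euclidean_space set"
  assumes C: "\<And>i. closed (C i)" "\<And>i. q \<in> C i" and D: "closed D" "q \<in> D" and \<rho>: "\<rho> > 0"
    and \<Phi>: "\<And>x. (\<Phi> has_derivative (\<lambda>h. inner (\<Phi>' x) h)) (at x)"
    and H: "\<And>x. (H has_derivative (\<lambda>h. inner (H' x) h)) (at x)" "H q = 0"
    and min: "\<forall>x \<in> D \<inter> (\<Inter>i. C i) \<inter> cball q \<rho>. H x = 0 \<longrightarrow> \<Phi> q \<le> \<Phi> x"
    and \<epsilon>: "\<epsilon> > 0"
  obtains Q P z \<mu> where "Q \<in> D" "dist Q q < \<epsilon>" "\<And>i. P i \<in> C i" "\<And>i. dist (P i) q < \<epsilon>"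
    "\<And>i. z i \<in> regular_normal_cone (P i) (C i)"
    "- (\<Phi>' Q + 2 *\<^sub>R (Q - q) + \<mu> *\<^sub>R H' Q + (\<Sum>i\<in>UNIV. z i)) \<in> regular_normal_cone Q D"
    "(\<forall>x. H x = 0) \<Longrightarrow> \<mu> = 0"
proof -
  have cont: "continuous_on UNIV \<Phi>" "continuous_on UNIV H"
    using \<Phi> H(1) by (auto intro!: has_derivative_continuous_on)
  define F where "F \<equiv> \<lambda>k Q (P :: 'i \<Rightarrow> 'a). \<Phi> Q + (norm (Q - q))\<^sup>2 +
             k * ((\<Sum>i\<in>UNIV. (norm (Q - P i))\<^sup>2) + (H Q)\<^sup>2)"
  \<comment> \<open>Points closer to \<open>q\<close> than \<rho> are interior to the ball, so the
    ball constraint does not enter the normal cones.\<close>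
  have \<epsilon>\<rho>: "min \<epsilon> \<rho> > 0" using \<epsilon> \<rho> by simp
  obtain k :: real and Q P where "k \<ge> 0" and Q: "Q \<in> D" "dist Q q < min \<epsilon> \<rho>"
    and P0: "\<forall>i. P i \<in> C i \<and> dist (P i) q < min \<epsilon> \<rho>"
    and kmin: "\<forall>Q'\<in>D \<inter> cball q \<rho>. \<forall>P'. (\<forall>i. P' i \<in> C i \<inter> cball q \<rho>) \<longrightarrow> F k Q P \<le> F k Q' P'"
    unfolding F_def
    by (rule penalty_minimizers_near[OF C D \<rho> cont H(2) min \<epsilon>\<rho>]) blast
  have P: "P i \<in> C i" "dist (P i) q < min \<epsilon> \<rho>" for i using P0 by auto
  have inball: "\<forall>\<^sub>F y in at p within S. y \<in> S \<inter> cball q \<rho>" if "dist p q < min \<epsilon> \<rho>" for p S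
  proof -
    have "\<forall>\<^sub>F y in at p within S. y \<in> ball q \<rho>"
      by (rule topological_tendstoD[OF tendsto_ident_at]) (use that in \<open>auto simp: dist_commute\<close>)
    moreover have "\<forall>\<^sub>F y in at p within S. y \<in> S"
      by (simp add: eventually_at_filter)
    ultimately show ?thesis by eventually_elim auto
  qed
  \<comment> \<open>The negative gradient of \<open>k * (norm (y - Q))\<^sup>2\<close> at
    \<open>y = P i\<close>. The same vector is the gradient of this penalty term in
    \<open>Q\<close>, which is how it reappears in the condition for \<open>Q\<close>.\<close>
  define z where "z = (\<lambda>i. - (k *\<^sub>R 2 *\<^sub>R (P i - Q)))"
  show thesis
  \<comment> \<open>The multiplier is the chain rule factor of \<open>H' Q\<close> in the derivative
    of \<open>k * (H Q)\<^sup>2\<close>.\<close>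
  proof (rule that[of Q P z "2 * k * H Q"])
    show "z i \<in> regular_normal_cone (P i) (C i)" for i
      unfolding z_def
    proof (rule regular_normal_cone_minimizer)
      show "((\<lambda>y. k * (norm (y - Q))\<^sup>2) has_derivative (\<lambda>h. inner (k *\<^sub>R 2 *\<^sub>R (P i - Q)) h))
          (at (P i) within C i)"
        using has_derivative_mult_right[OF square_norm_derivative, of k Q "P i" "C i"] by (simp add: mult.assoc)
      have "k * (norm (P i - Q))\<^sup>2 \<le> k * (norm (y - Q))\<^sup>2" if "y \<in> C i \<inter> cball q \<rho>" for y
      proof -
        \<comment> \<open>Only the \<open>i\<close>-th copy varies, so all other terms of
          \<open>F\<close> cancel.\<close>
        have "F k Q P \<le> F k Q (P(i := y))"
          by (rule kmin[rule_format]) (use Q P that in \<open>auto simp: dist_commute less_imp_le\<close>)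
        moreover have "(\<Sum>j\<in>UNIV. (norm (Q - (P(i := y)) j))\<^sup>2) =
            (norm (Q - y))\<^sup>2 + (\<Sum>j\<in>UNIV - {i}. (norm (Q - P j))\<^sup>2)"
          by (subst sum.remove[of _ i]) (auto intro!: sum.cong)
        moreover have "(\<Sum>j\<in>UNIV. (norm (Q - P j))\<^sup>2) =
            (norm (Q - P i))\<^sup>2 + (\<Sum>j\<in>UNIV - {i}. (norm (Q - P j))\<^sup>2)"
          by (subst sum.remove[of _ i]) auto
        ultimately show ?thesis
          by (simp add: F_def distrib_left norm_minus_commute)
      qed
      then show "\<forall>\<^sub>F y in at (P i) within C i. k * (norm (P i - Q))\<^sup>2 \<le> k * (norm (y - Q))\<^sup>2"
        by (rule eventually_mono[OF inball[OF P(2)]])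
    qed
    show "- (\<Phi>' Q + 2 *\<^sub>R (Q - q) + (2 * k * H Q) *\<^sub>R H' Q + (\<Sum>i\<in>UNIV. z i)) \<in> regular_normal_cone Q D"
    proof (rule regular_normal_cone_minimizer)
      have \<Phi>Q: "(\<Phi> has_derivative (\<lambda>h. inner (\<Phi>' Q) h)) (at Q within D)"
        and HQ: "(H has_derivative (\<lambda>h. inner (H' Q) h)) (at Q within D)"
        using \<Phi> H(1) by (auto intro: has_derivative_at_withinI)
      have "((\<lambda>y. F k y P) has_derivative (\<lambda>h. inner (\<Phi>' Q) h + inner (2 *\<^sub>R (Q - q)) h +
          k * ((\<Sum>i\<in>UNIV. inner (2 *\<^sub>R (Q - P i)) h) + 2 * (inner (H' Q) h * H Q)))) (at Q within D)"
        unfolding F_def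
        by (rule \<Phi>Q HQ square_norm_derivative derivative_eq_intros has_derivative_power refl | simp add: mult.assoc)+
      then show "((\<lambda>y. F k y P) has_derivative (\<lambda>h. inner (\<Phi>' Q + 2 *\<^sub>R (Q - q) +
          (2 * k * H Q) *\<^sub>R H' Q + (\<Sum>i\<in>UNIV. z i)) h)) (at Q within D)"
        by (rule has_derivative_eq_rhs)
          (simp add: z_def inner_add_left inner_sum_left sum_distrib_left sum_negf[symmetric] algebra_simps fun_eq_iff)
      have "F k Q P \<le> F k y P" if "y \<in> D \<inter> cball q \<rho>" for y
        by (rule kmin[rule_format]) (use P that in \<open>auto simp: dist_commute less_imp_le\<close>)
      then show "\<forall>\<^sub>F y in at Q within D. F k Q P \<le> F k y P"
        by (rule eventually_mono[OF inball[OF Q(2)]])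
    qed
  qed (use Q P in auto)
qed

section \<open>Existence of limiting subgradients\<close>

lemma locally_lipschitz_continuous_on:
  assumes "locally_lipschitz f" shows "continuous_on S f"
proof (rule continuous_at_imp_continuous_on, rule ballI)
  fix x
  obtain r L where "r > 0" "L-lipschitz_on (ball x r) f"
    using assms unfolding locally_lipschitz_def by blast
  then show "isCont f x"
    using lipschitz_on_continuous_on continuous_on_interior[of "ball x r" f x] by (auto simp: interior_open)
qed

text \<open>Minimize \<phi> plus \<open>c k\<close> times the squared distance to \<open>x\<close>
  over a ball. The Lipschitz constant bounds the resulting regular subgradients by
  \<open>2 * L\<close> and the minimizers tend to \<open>x\<close>, so a cluster point of these
  subgradients is a limiting one at \<open>x\<close>.\<close>

lemma limiting_subdifferential_nonempty:
  fixes \<phi> :: "'a::euclidean_space \<Rightarrow> real"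
  assumes "locally_lipschitz \<phi>"
  shows "limiting_subdifferential \<phi> x \<noteq> {}"
proof -
  obtain r L where r: "r > 0" and L: "L-lipschitz_on (ball x r) \<phi>"
    using assms unfolding locally_lipschitz_def by blast
  have L0: "L \<ge> 0" using L by (rule lipschitz_on_nonneg)
  have cont: "continuous_on S \<phi>" for S
    using assms by (rule locally_lipschitz_continuous_on)
  define \<rho> where "\<rho> = r / 2"
  have \<rho>: "0 < \<rho>" "\<rho> < r" using r by (auto simp: \<rho>_def)
  \<comment> \<open>The minimizer lies within \<open>L / c k\<close> of \<open>x\<close>. The
    summand \<open>L / \<rho>\<close> puts it inside the ball for every \<open>k\<close>, and
    \<open>Suc k\<close> drives it to \<open>x\<close>.\<close>
  define c where "c = (\<lambda>k. L / \<rho> + real (Suc k))"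
  have c: "c k > 0" for k using L0 \<rho> by (simp add: c_def add_nonneg_pos)
  have "\<exists>y\<in>cball x \<rho>. \<forall>z\<in>cball x \<rho>. \<phi> y + c k * (norm (y - x))\<^sup>2 \<le> \<phi> z + c k * (norm (z - x))\<^sup>2" for k
    by (rule continuous_attains_inf) (use \<rho> in \<open>auto intro!: continuous_intros cont\<close>)
  then obtain y where y: "\<And>k. y k \<in> cball x \<rho>"
    and ymin: "\<And>k z. z \<in> cball x \<rho> \<Longrightarrow>
      \<phi> (y k) + c k * (norm (y k - x))\<^sup>2 \<le> \<phi> z + c k * (norm (z - x))\<^sup>2"
    by metis
  \<comment> \<open>Compare the minimizer with \<open>x\<close> and divide by the distance between
    them.\<close>
  have slope: "c k * norm (y k - x) \<le> L" for k
  proof (cases "y k = x")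
    case False
    have "\<bar>\<phi> x - \<phi> (y k)\<bar> \<le> L * norm (x - y k)"
      using lipschitz_onD[OF L, of x "y k"] y[of k] \<rho> r by (simp add: dist_norm)
    then have "c k * (norm (y k - x))\<^sup>2 \<le> L * norm (y k - x)"
      using ymin[of x k] \<rho> by (simp add: norm_minus_commute)
    with False show ?thesis by (simp add: power2_eq_square)
  qed (use L0 in simp)
  have c_lim: "filterlim c at_top sequentially"
    unfolding c_def
    by (intro filterlim_tendsto_add_at_top[OF tendsto_const]
        filterlim_compose[OF filterlim_real_sequentially] filterlim_Suc)
  have ylim: "y \<longlonglongrightarrow> x"
  proof (rule Lim_null_comparison[of _ "\<lambda>k. L / c k", THEN LIM_zero_cancel])
    show "\<forall>\<^sub>F k in sequentially. norm (y k - x) \<le> L / c k"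
      using slope c by (intro always_eventually allI) (simp add: pos_le_divide_eq mult.commute)
    show "(\<lambda>k. L / c k) \<longlonglongrightarrow> 0"
      by (rule tendsto_divide_0[OF tendsto_const]) (rule filterlim_at_top_imp_at_infinity[OF c_lim])
  qed
  have interior: "y k \<in> ball x \<rho>" for k
  proof -
    have "\<rho> * c k = L + \<rho> * real (Suc k)"
      using \<rho> by (simp add: c_def distrib_left)
    then have "L < \<rho> * c k" using \<rho> by simp
    then have "L / c k < \<rho>" using c[of k] by (simp add: pos_divide_less_eq)
    moreover have "norm (y k - x) \<le> L / c k"
      using slope[of k] c[of k] by (simp add: pos_le_divide_eq mult.commute)
    ultimately show ?thesis by (simp add: dist_norm norm_minus_commute)
  qed
  define u where "u = (\<lambda>k. - (c k *\<^sub>R 2 *\<^sub>R (y k - x)))"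
  \<comment> \<open>Minimality over the ball turns into local minimality over the epigraph of a
    smooth function whose gradient has last entry 1.\<close>
  have normal: "(u k, - 1) \<in> regular_normal_cone (y k, \<phi> (y k)) (epigraph UNIV \<phi>)" for k
  proof -
    have "- (c k *\<^sub>R 2 *\<^sub>R (y k - x), 1) \<in> regular_normal_cone (y k, \<phi> (y k)) (epigraph UNIV \<phi>)"
    proof (rule regular_normal_cone_minimizer)
      show "((\<lambda>X. snd X + c k * (norm (fst X - x))\<^sup>2) has_derivative
          (\<lambda>h. inner (c k *\<^sub>R 2 *\<^sub>R (y k - x), 1) h)) (at (y k, \<phi> (y k)) within epigraph UNIV \<phi>)"
        unfolding power2_norm_eq_inner
        by (auto intro!: derivative_eq_intros simp: inner_prod_def inner_commute algebra_simps)
      have "\<forall>\<^sub>F X in at (y k, \<phi> (y k)) within epigraph UNIV \<phi>. X \<in> ball x \<rho> \<times> UNIV"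
        by (rule topological_tendstoD[OF tendsto_ident_at])
          (use interior in \<open>auto intro: open_Times\<close>)
      moreover have "\<forall>\<^sub>F X in at (y k, \<phi> (y k)) within epigraph UNIV \<phi>. X \<in> epigraph UNIV \<phi>"
        by (simp add: eventually_at_filter)
      ultimately show "\<forall>\<^sub>F X in at (y k, \<phi> (y k)) within epigraph UNIV \<phi>.
          snd (y k, \<phi> (y k)) + c k * (norm (fst (y k, \<phi> (y k)) - x))\<^sup>2 \<le> snd X + c k * (norm (fst X - x))\<^sup>2"
      proof eventually_elim
        case (elim X)
        then show ?case using ymin[of "fst X" k] by (auto simp: epigraph_def)
      qed
    qed
    then show ?thesis by (simp add: u_def)
  qed
  have "bounded (range u)"
    by (rule boundedI[of _ "2 * L"]) (use slope c in \<open>auto simp: u_def abs_of_pos\<close>)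
  then obtain v s where s: "strict_mono s" and v: "(u \<circ> s) \<longlonglongrightarrow> v"
    using bounded_imp_convergent_subsequence by blast
  have ys: "(\<lambda>k. y (s k)) \<longlonglongrightarrow> x"
    using LIMSEQ_subseq_LIMSEQ[OF ylim s] by (simp add: o_def)
  have "(\<lambda>k. \<phi> (y (s k))) \<longlonglongrightarrow> \<phi> x"
    by (rule continuous_on_tendsto_compose[OF cont[of UNIV] ys]) auto
  then have "(v, - 1) \<in> limiting_normal_cone (x, \<phi> x) (epigraph UNIV \<phi>)"
    unfolding limiting_normal_cone_def
    by (intro CollectI exI[of _ "\<lambda>k. (y (s k), \<phi> (y (s k)))"] exI[of _ "\<lambda>k. (u (s k), - 1)"])
      (use ys v normal in \<open>auto simp: o_def epigraph_def intro!: tendsto_Pair\<close>)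
  then show ?thesis by (auto simp: limiting_subdifferential_def)
qed

section \<open>Multiplier rule for a finite maximum\<close>

lemma closed_epigraph:
  fixes \<phi> :: "'a::topological_space \<Rightarrow> real"
  assumes "continuous_on UNIV \<phi>" shows "closed (epigraph UNIV \<phi>)"
proof -
  have "continuous_on UNIV (\<lambda>X :: 'a \<times> real. \<phi> (fst X))"
    by (rule continuous_on_compose2[OF assms]) (auto intro: continuous_intros)
  then show ?thesis
    unfolding epigraph_def by (simp add: closed_Collect_le continuous_on_snd)
qed

text \<open>
  \<open>(x, s)\<close> minimizes \<open>t + g y\<close> subject to \<open>y \<in> \<Omega>\<close>, \<open>f\<^sub>i y \<le> t\<close> and \<open>H y = 0\<close>, the epigraphical
  form of minimizing \<open>max\<^sub>i f\<^sub>i + g\<close>. The multipliers of the epigraph constraints add up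
  to 1 before normalization; afterwards their sum is the multiplier of \<open>g\<close>.
\<close>

lemma max_multiplier_rule:
  fixes f :: "'i::finite \<Rightarrow> 'a::euclidean_space \<Rightarrow> real"
  assumes f: "\<And>i. locally_lipschitz (f i)" and \<Omega>: "closed \<Omega>" "x \<in> \<Omega>" and \<rho>: "\<rho> > 0"
    and g: "\<And>y. (g has_derivative (\<lambda>h. inner (G y) h)) (at y)" "continuous_on UNIV G"
    and H: "\<And>y. (H has_derivative (\<lambda>h. inner (H' y) h)) (at y)" "continuous_on UNIV H'" "H x = 0"
    and s: "\<And>i. f i x \<le> s"
    and min: "\<forall>y \<in> \<Omega> \<inter> cball x \<rho>. \<forall>t. H y = 0 \<longrightarrow> (\<forall>i. f i y \<le> t) \<longrightarrow> s + g x \<le> t + g y"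
  obtains l v \<mu> w where "\<And>i. 0 \<le> l i" "(\<Sum>i\<in>UNIV. l i) + \<bar>\<mu>\<bar> = 1"
    "\<And>i. v i \<in> limiting_subdifferential (f i) x" "w \<in> limiting_normal_cone x \<Omega>"
    "(\<Sum>i\<in>UNIV. l i *\<^sub>R v i) + (\<Sum>i\<in>UNIV. l i) *\<^sub>R G x + \<mu> *\<^sub>R H' x + w = 0"
    "(\<forall>y. H y = 0) \<Longrightarrow> \<mu> = 0"
proof -
  have "\<exists>r L. r > 0 \<and> L-lipschitz_on (ball x r) (f i)" for i
    using f unfolding locally_lipschitz_def by blast
  then obtain R L where R: "\<And>i. R i > 0" and L: "\<And>i. (L i)-lipschitz_on (ball x (R i)) (f i)"
    by metis
  \<comment> \<open>At most every \<open>R i\<close>, so that \<open>epigraph_normal\<close> applies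
    near \<open>x\<close>, and at most \<open>1 / 4\<close>, so that the total \<open>N n\<close>
    below stays at least \<open>1 / 2\<close>.\<close>
  define r where "r = Min (insert (1 / 4) (range R))"
  have r: "r > 0" "r \<le> 1 / 4" "r \<le> R i" for i using R by (auto simp: r_def min_le_iff_disj)
  have cf: "continuous_on UNIV (f i)" for i using f by (rule locally_lipschitz_continuous_on)
  let ?E = "\<lambda>i. epigraph UNIV (f i)"
  \<comment> \<open>\<open>approximate_multipliers\<close> in the product space, with
    \<open>\<Omega> \<times> UNIV\<close> as \<open>D\<close>, the epigraphs as \<open>C i\<close>
    and \<open>snd X + g (fst X)\<close> as objective.\<close>
  have "\<exists>Q P z \<mu>. Q \<in> \<Omega> \<times> UNIV \<and> dist Q (x, s) < r / real (Suc n) \<and>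
      (\<forall>i. P i \<in> ?E i \<and> dist (P i) (x, s) < r / real (Suc n) \<and> z i \<in> regular_normal_cone (P i) (?E i)) \<and>
      - ((G (fst Q), 1) + 2 *\<^sub>R (Q - (x, s)) + \<mu> *\<^sub>R (H' (fst Q), 0) + (\<Sum>i\<in>UNIV. z i))
        \<in> regular_normal_cone Q (\<Omega> \<times> UNIV) \<and> ((\<forall>y. H y = 0) \<longrightarrow> \<mu> = 0)" (is "?ex n") for n
  proof -
    have d1: "((\<lambda>X. snd X + g (fst X)) has_derivative (\<lambda>h. inner (G (fst X), 1) h)) (at X)"
      for X :: "'a \<times> real"
      by (rule has_derivative_eq_rhs, rule has_derivative_add[OF has_derivative_snd[OF has_derivative_ident]
          has_derivative_compose[OF has_derivative_fst[OF has_derivative_ident] g(1)]])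
        (simp add: inner_prod_def fun_eq_iff)
    have d2: "((\<lambda>X. H (fst X)) has_derivative (\<lambda>h. inner (H' (fst X), 0) h)) (at X)"
      for X :: "'a \<times> real"
      by (rule has_derivative_eq_rhs,
          rule has_derivative_compose[OF has_derivative_fst[OF has_derivative_ident] H(1)])
        (simp add: inner_prod_def fun_eq_iff)
    have m: "\<forall>X \<in> (\<Omega> \<times> UNIV) \<inter> (\<Inter>i. ?E i) \<inter> cball (x, s) \<rho>. H (fst X) = 0 \<longrightarrow>
        snd (x, s) + g (fst (x, s)) \<le> snd X + g (fst X)"
    proof (intro ballI impI)
      fix X assume X: "X \<in> (\<Omega> \<times> UNIV) \<inter> (\<Inter>i. ?E i) \<inter> cball (x, s) \<rho>" "H (fst X) = 0"
      then have "fst X \<in> \<Omega> \<inter> cball x \<rho>"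
        using dist_fst_le[of "(x, s)" X] by auto
      moreover have "\<forall>i. f i (fst X) \<le> snd X" using X by (auto simp: epigraph_def)
      ultimately show "snd (x, s) + g (fst (x, s)) \<le> snd X + g (fst X)" using min X(2) by simp
    qed
    have cl: "closed (\<Omega> \<times> (UNIV :: real set))" using \<Omega> by (intro closed_Times) auto
    show "?ex n"
    proof (rule approximate_multipliers[where \<epsilon> = "r / real (Suc n)",
            OF closed_epigraph[OF cf] _ cl _ \<rho> d1 d2 _ m])
      fix Q P z \<mu>
      assume "Q \<in> \<Omega> \<times> UNIV" "dist Q (x, s) < r / real (Suc n)"
        "\<And>i. P i \<in> ?E i" "\<And>i. dist (P i) (x, s) < r / real (Suc n)"
        "\<And>i. z i \<in> regular_normal_cone (P i) (?E i)"
        "- ((G (fst Q), 1) + 2 *\<^sub>R (Q - (x, s)) + \<mu> *\<^sub>R (H' (fst Q), 0) + (\<Sum>i\<in>UNIV. z i))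
          \<in> regular_normal_cone Q (\<Omega> \<times> UNIV)" "\<forall>X :: 'a \<times> real. H (fst X) = 0 \<Longrightarrow> \<mu> = 0"
      then show "?ex n"
        by (intro exI[of _ Q] exI[of _ P] exI[of _ z] exI[of _ \<mu>]) simp
    qed (use s \<Omega> H(3) r(1) in \<open>simp_all add: mem_epigraph\<close>)
  qed
  then obtain Q P z \<mu> where Q: "\<And>n. Q n \<in> \<Omega> \<times> UNIV" "\<And>n. dist (Q n) (x, s) < r / real (Suc n)"
    and P: "\<And>n i. P n i \<in> ?E i" "\<And>n i. dist (P n i) (x, s) < r / real (Suc n)"
    and z: "\<And>n i. z n i \<in> regular_normal_cone (P n i) (?E i)"
    and w0: "\<And>n. - ((G (fst (Q n)), 1) + 2 *\<^sub>R (Q n - (x, s)) + \<mu> n *\<^sub>R (H' (fst (Q n)), 0) +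
        (\<Sum>i\<in>UNIV. z n i)) \<in> regular_normal_cone (Q n) (\<Omega> \<times> UNIV)"
    and \<mu>0: "\<And>n. (\<forall>y. H y = 0) \<Longrightarrow> \<mu> n = 0"
    by metis
  have small: "r / real (Suc n) \<le> r" for n using r(1) by (simp add: field_simps)
  have r_lim: "(\<lambda>n. r / real (Suc n)) \<longlonglongrightarrow> 0"
    using LIMSEQ_Suc[OF lim_const_over_n] by simp
  have lim: "X \<longlonglongrightarrow> q" if "\<And>n. dist (X n) q < r / real (Suc n)" for X and q :: "'a \<times> real"
    unfolding tendsto_dist_iff[of X q]
    by (rule tendsto_sandwich[OF _ _ tendsto_const r_lim])
      (use that in \<open>auto intro!: always_eventually less_imp_le simp del: of_nat_Suc\<close>)
  have Qlim: "Q \<longlonglongrightarrow> (x, s)" and Plim: "(\<lambda>n. P n i) \<longlonglongrightarrow> (x, s)" for i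
    by (rule lim, rule Q(2)) (rule lim, rule P(2))
  \<comment> \<open>The base part of the normal to \<open>\<Omega> \<times> UNIV\<close>. Its real
    part vanishes, which says that the epigraph multipliers \<open>- snd (z n i)\<close> sum to
    nearly 1.\<close>
  define \<omega> where "\<omega> = (\<lambda>n. - (G (fst (Q n)) + 2 *\<^sub>R (fst (Q n) - x) + \<mu> n *\<^sub>R H' (fst (Q n)) +
      (\<Sum>i\<in>UNIV. fst (z n i))))"
  have \<omega>: "\<omega> n \<in> regular_normal_cone (fst (Q n)) \<Omega>"
    and snd0: "1 + 2 * (snd (Q n) - s) = (\<Sum>i\<in>UNIV. - snd (z n i))" for n
  proof -
    let ?V = "- ((G (fst (Q n)), 1) + 2 *\<^sub>R (Q n - (x, s)) + \<mu> n *\<^sub>R (H' (fst (Q n)), 0) +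
        (\<Sum>i\<in>UNIV. z n i))"
    have V: "?V \<in> regular_normal_cone (fst (Q n), snd (Q n)) (\<Omega> \<times> UNIV)" and "fst (Q n) \<in> \<Omega>"
      using w0[of n] Q(1)[of n] by auto
    note regular_normal_cone_Times_UNIV[OF this]
    moreover have "fst ?V = \<omega> n" by (simp add: \<omega>_def fst_sum)
    moreover have "snd ?V = (\<Sum>i\<in>UNIV. - snd (z n i)) - (1 + 2 * (snd (Q n) - s))"
      by (simp add: snd_sum sum_negf)
    ultimately show "\<omega> n \<in> regular_normal_cone (fst (Q n)) \<Omega>"
      "1 + 2 * (snd (Q n) - s) = (\<Sum>i\<in>UNIV. - snd (z n i))"
      by simp_all
  qed
  have z_lip: "0 \<le> - snd (z n i)" "norm (fst (z n i)) \<le> L i * (- snd (z n i))"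
    "0 < - snd (z n i) \<Longrightarrow> snd (P n i) = f i (fst (P n i))" for n i
  proof -
    have "(fst (z n i), - (- snd (z n i))) \<in> regular_normal_cone (fst (P n i), snd (P n i)) (?E i)"
      using z by simp
    moreover have "f i (fst (P n i)) \<le> snd (P n i)" using P(1)[of n i] by (simp add: epigraph_def)
    moreover have "dist (fst (P n i)) x < R i"
      using dist_fst_le[of "P n i" "(x, s)"] P(2)[of n i] small[of n] r(3)[of i] by simp
    then have "fst (P n i) \<in> ball x (R i)" by (simp add: dist_commute)
    ultimately show "0 \<le> - snd (z n i)" "norm (fst (z n i)) \<le> L i * (- snd (z n i))"
      "0 < - snd (z n i) \<Longrightarrow> snd (P n i) = f i (fst (P n i))"
      using epigraph_normal[OF _ _ L] by blast+
  qed
  \<comment> \<open>The multipliers \<open>\<mu> n\<close> carry no bound, so everything is divided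
    by the total size. It stays away from 0 because \<open>snd (Q n)\<close> is within
    \<open>1 / 4\<close> of \<open>s\<close>.\<close>
  define N where "N = (\<lambda>n. (\<Sum>i\<in>UNIV. - snd (z n i)) + \<bar>\<mu> n\<bar>)"
  have "N n \<ge> 1 / 2" for n
    using dist_snd_le[of "Q n" "(x, s)"] Q(2)[of n] small[of n] r(2) snd0[of n]
    by (auto simp: N_def dist_real_def)
  then have N: "N n > 0" "inverse (N n) \<le> 2" for n
    using le_imp_inverse_le[of "1 / 2" "N n"] by (auto simp: less_le_trans[of 0 "1 / 2"])
  \<comment> \<open>All normalized quantities form one bounded vector, so one subsequence serves
    them all.\<close>
  define T where "T = (\<lambda>n. (inverse (N n), inverse (N n) * \<mu> n, \<chi> i. inverse (N n) *\<^sub>R z n i))"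
  have "norm (T n) \<le> 2 + (1 + (\<Sum>i\<in>UNIV. L i + 1))" for n
  proof -
    have "norm (z n i) \<le> (L i + 1) * N n" for i
    proof -
      have "- snd (z n i) \<le> (\<Sum>i\<in>UNIV. - snd (z n i))"
        by (rule member_le_sum) (use z_lip in auto)
      then have "- snd (z n i) \<le> N n" by (simp add: N_def)
      moreover have "norm (z n i) \<le> norm (fst (z n i)) + norm (snd (z n i))"
        by (metis norm_Pair_le prod.collapse)
      moreover have "norm (snd (z n i)) = - snd (z n i)" using z_lip(1)[of n i] by simp
      ultimately show ?thesis
        using z_lip(2)[of n i] mult_left_mono[of "- snd (z n i)" "N n" "L i + 1"] lipschitz_on_nonneg[OF L[of i]]
        by (simp add: distrib_right)
    qed
    then have "norm (inverse (N n) *\<^sub>R z n i) \<le> L i + 1" for i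
      using N(1)[of n] by (simp add: field_simps)
    then have "norm (\<chi> i. inverse (N n) *\<^sub>R z n i) \<le> (\<Sum>i\<in>UNIV. L i + 1)"
      unfolding norm_vec_def by (intro order_trans[OF L2_set_le_sum sum_mono]) auto
    moreover have "norm (inverse (N n) * \<mu> n) \<le> 1"
    proof -
      have "\<bar>\<mu> n\<bar> \<le> N n" unfolding N_def using z_lip(1) by (simp add: sum_nonneg)
      then show ?thesis using N(1)[of n] by (simp add: abs_mult field_simps)
    qed
    moreover have "norm (inverse (N n)) \<le> 2" using N[of n] by simp
    moreover have "norm (T n) \<le> norm (inverse (N n)) +
        (norm (inverse (N n) * \<mu> n) + norm (\<chi> i. inverse (N n) *\<^sub>R z n i))"
      unfolding T_def by (intro order_trans[OF norm_Pair_le] add_left_mono norm_Pair_le)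
    ultimately show ?thesis by linarith
  qed
  then have "bounded (range T)" by (intro boundedI) auto
  then obtain \<tau> k where k: "strict_mono k" and \<tau>: "(\<lambda>n. T (k n)) \<longlonglongrightarrow> \<tau>"
    using bounded_imp_convergent_subsequence[of T] by (auto simp: o_def)
  obtain a m Z where aZ: "\<tau> = (a, m, Z)" by (cases \<tau>)
  have alim: "(\<lambda>n. inverse (N (k n))) \<longlonglongrightarrow> a"
    using tendsto_fst[OF \<tau>] by (simp add: T_def aZ)
  have mlim: "(\<lambda>n. inverse (N (k n)) * \<mu> (k n)) \<longlonglongrightarrow> m"
    using tendsto_fst[OF tendsto_snd[OF \<tau>]] by (simp add: T_def aZ)
  have Zlim: "(\<lambda>n. inverse (N (k n)) *\<^sub>R z (k n) i) \<longlonglongrightarrow> Z $ i" for i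
    using tendsto_vec_nth[OF tendsto_snd[OF tendsto_snd[OF \<tau>]], of i] by (simp add: T_def aZ)
  have Qk: "(\<lambda>n. Q (k n)) \<longlonglongrightarrow> (x, s)" and Pk: "(\<lambda>n. P (k n) i) \<longlonglongrightarrow> (x, s)" for i
    using LIMSEQ_subseq_LIMSEQ[OF Qlim k] LIMSEQ_subseq_LIMSEQ[OF Plim k] by (auto simp: o_def)
  have Qk1: "(\<lambda>n. fst (Q (k n))) \<longlonglongrightarrow> x" and Qk2: "(\<lambda>n. snd (Q (k n))) \<longlonglongrightarrow> s"
    using tendsto_fst[OF Qk] tendsto_snd[OF Qk] by auto
  have Z1: "(\<lambda>n. inverse (N (k n)) *\<^sub>R fst (z (k n) i)) \<longlonglongrightarrow> fst (Z $ i)"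
    and Z2: "(\<lambda>n. inverse (N (k n)) * - snd (z (k n) i)) \<longlonglongrightarrow> - snd (Z $ i)" for i
    using tendsto_fst[OF Zlim, of i] tendsto_minus[OF tendsto_snd[OF Zlim, of i]] by auto
  define l where "l = (\<lambda>i. - snd (Z $ i))"
  have l0: "l i \<ge> 0" for i
    unfolding l_def
  proof (rule LIMSEQ_le_const[OF Z2], intro exI allI impI)
    fix n show "0 \<le> inverse (N (k n)) * - snd (z (k n) i)"
      by (rule mult_nonneg_nonneg[OF less_imp_le z_lip(1)]) (simp add: N(1))
  qed
  have Z_lip: "norm (fst (Z $ i)) \<le> L i * l i" for i
    unfolding l_def
  proof (rule LIMSEQ_le[OF tendsto_norm[OF Z1] tendsto_mult_left[OF Z2]], intro exI allI impI)
    fix n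
    show "norm (inverse (N (k n)) *\<^sub>R fst (z (k n) i)) \<le> L i * (inverse (N (k n)) * - snd (z (k n) i))"
      using z_lip(2)[of "k n" i] N(1)[of "k n"] by (simp add: field_simps)
  qed
  have l_sum: "(\<Sum>i\<in>UNIV. l i) + \<bar>m\<bar> = 1"
  proof (rule LIMSEQ_unique)
    show "(\<lambda>n. (\<Sum>i\<in>UNIV. inverse (N (k n)) * - snd (z (k n) i)) + \<bar>inverse (N (k n)) * \<mu> (k n)\<bar>)
        \<longlonglongrightarrow> (\<Sum>i\<in>UNIV. l i) + \<bar>m\<bar>"
      unfolding l_def by (intro tendsto_add tendsto_sum tendsto_rabs Z2 mlim)
    have "(\<Sum>i\<in>UNIV. inverse (N n) * - snd (z n i)) + \<bar>inverse (N n) * \<mu> n\<bar> = inverse (N n) * N n" for n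
      using N(1)[of n] by (simp add: N_def[of] abs_mult distrib_left sum_distrib_left)
    then show "(\<lambda>n. (\<Sum>i\<in>UNIV. inverse (N (k n)) * - snd (z (k n) i)) + \<bar>inverse (N (k n)) * \<mu> (k n)\<bar>) \<longlonglongrightarrow> 1"
      using N(1) by (simp add: less_imp_neq[symmetric])
  qed
  \<comment> \<open>The limit of \<open>snd0\<close> divided by the totals. It explains why the
    coefficient of \<open>G x\<close> is the sum of the \<open>l i\<close>.\<close>
  have a_sum: "a = (\<Sum>i\<in>UNIV. l i)"
  proof (rule LIMSEQ_unique)
    show "(\<lambda>n. \<Sum>i\<in>UNIV. inverse (N (k n)) * - snd (z (k n) i)) \<longlonglongrightarrow> (\<Sum>i\<in>UNIV. l i)"
      unfolding l_def by (intro tendsto_sum Z2)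
    have "(\<lambda>n. inverse (N (k n)) * (1 + 2 * (snd (Q (k n)) - s))) \<longlonglongrightarrow> a * (1 + 2 * (s - s))"
      by (intro tendsto_intros alim Qk2)
    then show "(\<lambda>n. \<Sum>i\<in>UNIV. inverse (N (k n)) * - snd (z (k n) i)) \<longlonglongrightarrow> a"
      unfolding snd0 by (simp add: sum_distrib_left)
  qed
  define w where "w = - (a *\<^sub>R G x + m *\<^sub>R H' x + (\<Sum>i\<in>UNIV. fst (Z $ i)))"
  have "(\<lambda>n. - (inverse (N (k n)) *\<^sub>R (G (fst (Q (k n))) + 2 *\<^sub>R (fst (Q (k n)) - x)) +
      (inverse (N (k n)) * \<mu> (k n)) *\<^sub>R H' (fst (Q (k n))) +
      (\<Sum>i\<in>UNIV. inverse (N (k n)) *\<^sub>R fst (z (k n) i))))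
      \<longlonglongrightarrow> - (a *\<^sub>R (G x + 2 *\<^sub>R (x - x)) + m *\<^sub>R H' x + (\<Sum>i\<in>UNIV. fst (Z $ i)))"
    by (intro tendsto_intros alim mlim Z1 Qk1 continuous_on_tendsto_compose[OF g(2)]
        continuous_on_tendsto_compose[OF H(2)]) auto
  moreover have "inverse (N n) *\<^sub>R \<omega> n = - (inverse (N n) *\<^sub>R (G (fst (Q n)) + 2 *\<^sub>R (fst (Q n) - x)) +
      (inverse (N n) * \<mu> n) *\<^sub>R H' (fst (Q n)) + (\<Sum>i\<in>UNIV. inverse (N n) *\<^sub>R fst (z n i)))" for n
    by (simp add: \<omega>_def scaleR_sum_right[symmetric] scaleR_add_right scaleR_diff_right)
  ultimately have "(\<lambda>n. inverse (N (k n)) *\<^sub>R \<omega> (k n)) \<longlonglongrightarrow> w"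
    by (simp add: w_def)
  then have w: "w \<in> limiting_normal_cone x \<Omega>"
    unfolding limiting_normal_cone_def
    by (intro CollectI exI[of _ "\<lambda>n. fst (Q (k n))"] exI[of _ "\<lambda>n. inverse (N (k n)) *\<^sub>R \<omega> (k n)"])
      (use Qk1 Q(1) \<omega> N(1) in \<open>auto simp: mem_Times_iff intro!: regular_normal_cone_scaleR\<close>)
  have Zn: "Z $ i \<in> limiting_normal_cone (x, s) (?E i)" for i
    unfolding limiting_normal_cone_def
    by (intro CollectI exI[of _ "\<lambda>n. P (k n) i"] exI[of _ "\<lambda>n. inverse (N (k n)) *\<^sub>R z (k n) i"])
      (use Pk Zlim P(1) z N(1) in \<open>auto intro!: regular_normal_cone_scaleR\<close>)
  \<comment> \<open>Complementary slackness: a positive limit multiplier puts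
    \<open>P (k n) i\<close> on the graph for all large \<open>n\<close>.\<close>
  have active: "f i x = s" if "l i > 0" for i
  proof (rule LIMSEQ_unique)
    have P1: "(\<lambda>n. fst (P (k n) i)) \<longlonglongrightarrow> x" using tendsto_fst[OF Pk[of i]] by simp
    show "(\<lambda>n. f i (fst (P (k n) i))) \<longlonglongrightarrow> f i x"
      by (rule continuous_on_tendsto_compose[OF cf P1]) auto
    have "\<forall>\<^sub>F n in sequentially. inverse (N (k n)) * - snd (z (k n) i) > 0"
      by (rule order_tendstoD(1)[OF Z2]) (use that in \<open>simp add: l_def\<close>)
    then have "\<forall>\<^sub>F n in sequentially. snd (P (k n) i) = f i (fst (P (k n) i))"
    proof eventually_elim
      case (elim n)
      then have "0 < - snd (z (k n) i)"
        using N(1)[of "k n"] by (simp add: zero_less_mult_iff mult_less_0_iff)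
      then show ?case by (rule z_lip(3))
    qed
    moreover have "(\<lambda>n. snd (P (k n) i)) \<longlonglongrightarrow> s" using tendsto_snd[OF Pk[of i]] by simp
    ultimately show "(\<lambda>n. f i (fst (P (k n) i))) \<longlonglongrightarrow> s" by (simp add: tendsto_cong)
  qed
  \<comment> \<open>A positive \<open>l i\<close> allows rescaling \<open>Z $ i\<close> to last
    entry \<open>- 1\<close>. For \<open>l i = 0\<close> the bound \<open>Z_lip\<close> makes the
    base part zero, and any subgradient serves; one exists by
    \<open>limiting_subdifferential_nonempty\<close>.\<close>
  have "\<exists>v. v \<in> limiting_subdifferential (f i) x \<and> l i *\<^sub>R v = fst (Z $ i)" for i
  proof (cases "l i > 0")
    case True
    then have "inverse (l i) *\<^sub>R Z $ i \<in> limiting_normal_cone (x, f i x) (?E i)"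
      using Zn[of i] active[OF True] by (simp add: limiting_normal_cone_scaleR)
    moreover have "inverse (l i) *\<^sub>R Z $ i = (inverse (l i) *\<^sub>R fst (Z $ i), - 1)"
      using True by (cases "Z $ i") (simp add: l_def)
    ultimately have "inverse (l i) *\<^sub>R fst (Z $ i) \<in> limiting_subdifferential (f i) x"
      by (simp add: limiting_subdifferential_def)
    with True show ?thesis by (intro exI[of _ "inverse (l i) *\<^sub>R fst (Z $ i)"]) simp
  next
    case False
    then have "l i = 0" using l0[of i] by simp
    then show ?thesis
      using Z_lip[of i] limiting_subdifferential_nonempty[OF f, of i x] by auto
  qed
  then obtain v where v: "\<And>i. v i \<in> limiting_subdifferential (f i) x" "\<And>i. l i *\<^sub>R v i = fst (Z $ i)"
    by metis
  show thesis
  proof (rule that[of l m v w, OF l0 l_sum v(1) w])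
    show "(\<Sum>i\<in>UNIV. l i *\<^sub>R v i) + (\<Sum>i\<in>UNIV. l i) *\<^sub>R G x + m *\<^sub>R H' x + w = 0"
      by (simp add: v(2) w_def a_sum)
    show "m = 0" if "\<forall>y. H y = 0"
      using mlim \<mu>0[OF that] LIMSEQ_unique[OF _ tendsto_const] by fastforce
  qed
qed

section \<open>Minimization at infinity\<close>

lemma regular_normal_cone_translation:
  assumes v: "v \<in> regular_normal_cone x S" and T: "\<And>y. y \<in> T \<Longrightarrow> y - a \<in> S"
  shows "v \<in> regular_normal_cone (x + a) T"
  unfolding regular_normal_cone_iff
proof (intro allI impI)
  fix e :: real assume "e > 0"
  then obtain d where d: "d > 0"
    "\<forall>y\<in>S. y \<noteq> x \<and> dist y x < d \<longrightarrow> inner v (y - x) \<le> e * norm (y - x)"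
    using v unfolding regular_normal_cone_iff eventually_at by blast
  show "\<forall>\<^sub>F y in at (x + a) within T. inner v (y - (x + a)) \<le> e * norm (y - (x + a))"
    unfolding eventually_at
  proof (intro exI[of _ d] conjI ballI impI)
    fix y assume "y \<in> T" "y \<noteq> x + a \<and> dist y (x + a) < d"
    then show "inner v (y - (x + a)) \<le> e * norm (y - (x + a))"
      using d(2)[rule_format, OF T, of y] by (auto simp: dist_norm algebra_simps)
  qed (fact d(1))
qed

text \<open>The two epigraphs differ by a vertical translation, which preserves normals. This
  removes \<open>ybar\<close> from the subgradients of the shifted components.\<close>

lemma limiting_subdifferential_diff_const:
  assumes "v \<in> limiting_subdifferential (\<lambda>z. \<phi> z - c) x"
  shows "v \<in> limiting_subdifferential \<phi> x"
proof -
  let ?E = "epigraph UNIV (\<lambda>z. \<phi> z - c)"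
  obtain X u where X: "X \<longlonglongrightarrow> (x, \<phi> x - c)" "\<And>k. X k \<in> ?E" "u \<longlonglongrightarrow> (v, - 1)"
    "\<And>k. u k \<in> regular_normal_cone (X k) ?E"
    using assms by (auto simp: limiting_subdifferential_def limiting_normal_cone_def)
  have "u k \<in> regular_normal_cone (X k + (0, c)) (epigraph UNIV \<phi>)" for k
    by (rule regular_normal_cone_translation[OF X(4)]) (auto simp: epigraph_def)
  moreover have "(\<lambda>k. X k + (0, c)) \<longlonglongrightarrow> (x, \<phi> x)"
    using tendsto_add[OF X(1) tendsto_const[of "(0, c)"]] by simp
  moreover have "X k + (0, c) \<in> epigraph UNIV \<phi>" for k
    using X(2)[of k] by (simp add: epigraph_def diff_le_eq)
  ultimately show ?thesis
    unfolding limiting_subdifferential_def limiting_normal_cone_def using X(3) by blast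
qed

text \<open>The scalarization of \<open>f\<close>: its zero sublevel set is \<open>{x. f x \<le> y}\<close>, so decreasing it
  preserves the constraint \<open>f x \<le> y\<close>.\<close>

definition excess :: "('a \<Rightarrow> real ^ 'm) \<Rightarrow> real ^ 'm \<Rightarrow> 'a \<Rightarrow> real" where
  "excess f y x = Max (range (\<lambda>i. f x $ i - y $ i))"

lemma excess_le_iff: "excess f y x \<le> t \<longleftrightarrow> (\<forall>i. f x $ i - y $ i \<le> t)"
  by (auto simp: excess_def)

lemma component_le_excess: "f x $ i - y $ i \<le> excess f y x"
  by (simp add: excess_def)

lemma excess_nonpos_iff: "excess f y x \<le> 0 \<longleftrightarrow> f x \<le> y"
  by (simp add: excess_le_iff less_eq_vec_def)

lemma continuous_on_Max_image:
  fixes h :: "'i \<Rightarrow> 'a::topological_space \<Rightarrow> real"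
  assumes "finite I" "I \<noteq> {}" "\<And>i. i \<in> I \<Longrightarrow> continuous_on S (h i)"
  shows "continuous_on S (\<lambda>x. Max ((\<lambda>i. h i x) ` I))"
  using assms by (induction I rule: finite_ne_induct) (auto intro!: continuous_on_max)

lemma continuous_on_excess:
  assumes "continuous_on S f" shows "continuous_on S (excess f y)"
  unfolding excess_def
  by (rule continuous_on_Max_image) (auto intro!: continuous_intros assms)

lemma locally_lipschitz_component:
  fixes f :: "'a::metric_space \<Rightarrow> real ^ 'm"
  assumes "locally_lipschitz f" shows "locally_lipschitz (\<lambda>x. f x $ i - c)"
  unfolding locally_lipschitz_def
proof
  fix x
  obtain r L where r: "r > 0" and L: "L-lipschitz_on (ball x r) f"
    using assms unfolding locally_lipschitz_def by blast
  have "L-lipschitz_on (ball x r) (\<lambda>x. f x $ i - c)"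
  proof (rule lipschitz_onI)
    fix y z assume "y \<in> ball x r" "z \<in> ball x r"
    then have "dist (f y) (f z) \<le> L * dist y z" by (rule lipschitz_onD[OF L])
    then show "dist (f y $ i - c) (f z $ i - c) \<le> L * dist y z"
      using dist_vec_nth_le[of "f y" i "f z"] by (simp add: dist_real_def)
  qed (rule lipschitz_on_nonneg[OF L])
  with r show "\<exists>r>0. \<exists>L. L-lipschitz_on (ball x r) (\<lambda>x. f x $ i - c)" by blast
qed

text \<open>The shifted components with \<open>s = excess f ybar x\<close> fit
  \<open>max_multiplier_rule\<close>, because a common upper bound \<open>t\<close> of them at
  \<open>y\<close> also bounds the excess there.\<close>

lemma excess_multiplier_rule:
  fixes f :: "real ^ 'n \<Rightarrow> real ^ 'm"
  assumes f: "locally_lipschitz f" and \<Omega>: "closed \<Omega>" "x \<in> \<Omega>" and \<rho>: "\<rho> > 0"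
    and g: "\<And>y. (g has_derivative (\<lambda>h. inner (G y) h)) (at y)" "continuous_on UNIV G"
    and H: "\<And>y. (H has_derivative (\<lambda>h. inner (H' y) h)) (at y)" "continuous_on UNIV H'" "H x = 0"
    and min: "\<forall>y \<in> \<Omega> \<inter> cball x \<rho>. H y = 0 \<longrightarrow> excess f ybar x + g x \<le> excess f ybar y + g y"
  obtains v and l :: "real ^ 'm" and \<mu> w
  where "\<forall>i. v i \<in> symmetric_subdifferential (\<lambda>z. f z $ i) x" "l \<in> {0..}"
    "(\<Sum>i\<in>UNIV. l $ i) + \<bar>\<mu>\<bar> = 1" "w \<in> limiting_normal_cone x \<Omega>"
    "(\<Sum>i\<in>UNIV. l $ i *\<^sub>R v i) + (\<Sum>i\<in>UNIV. l $ i) *\<^sub>R G x + \<mu> *\<^sub>R H' x + w = 0"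
    "(\<forall>y. H y = 0) \<longrightarrow> \<mu> = 0"
proof -
  have m: "\<forall>y \<in> \<Omega> \<inter> cball x \<rho>. \<forall>t. H y = 0 \<longrightarrow> (\<forall>i. f y $ i - ybar $ i \<le> t) \<longrightarrow>
      excess f ybar x + g x \<le> t + g y"
  proof (intro ballI allI impI)
    fix y t assume y: "y \<in> \<Omega> \<inter> cball x \<rho>" "H y = 0" and "\<forall>i. f y $ i - ybar $ i \<le> t"
    then have "excess f ybar y \<le> t" by (simp add: excess_le_iff)
    with min y show "excess f ybar x + g x \<le> t + g y" by fastforce
  qed
  show thesis
  proof (rule max_multiplier_rule[OF locally_lipschitz_component[OF f] \<Omega> \<rho> g H component_le_excess m])
    fix l v \<mu> w
    assume l: "\<And>i. 0 \<le> l i" "(\<Sum>i\<in>UNIV. l i) + \<bar>\<mu>\<bar> = 1"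
      and v: "\<And>i. v i \<in> limiting_subdifferential (\<lambda>z. f z $ i - ybar $ i) x"
      and w: "w \<in> limiting_normal_cone x \<Omega>"
      and eq: "(\<Sum>i\<in>UNIV. l i *\<^sub>R v i) + (\<Sum>i\<in>UNIV. l i) *\<^sub>R G x + \<mu> *\<^sub>R H' x + w = 0"
      and \<mu>: "(\<forall>y. H y = 0) \<Longrightarrow> \<mu> = 0"
    have "v i \<in> symmetric_subdifferential (\<lambda>z. f z $ i) x" for i
      using limiting_subdifferential_diff_const[OF v] by (simp add: symmetric_subdifferential_def)
    with l w eq \<mu> show thesis
      by (intro that[of v "\<chi> i. l i" \<mu> w]) (simp_all add: less_eq_vec_def)
  qed
qed

text \<open>The infima \<open>m R\<close> of \<psi> over the points of norm at least
  \<open>R\<close> have a finite supremum \<open>c\<close>. Beyond \<open>R'\<close> all values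
  exceed \<open>c - \<delta> / 2\<close>, while some \<open>x\<close> of norm at least
  \<open>2 * R'\<close> has a value below \<open>c + \<delta> / 2\<close>. The factor 2 leaves room
  for the ball of radius \<open>norm x / 2\<close> around \<open>x\<close>.\<close>

lemma almost_minimizer_at_infinity:
  fixes S :: "'a::real_normed_vector set" and \<psi> :: "'a \<Rightarrow> real"
  assumes S: "\<not> bounded S" and \<psi>: "\<And>x. x \<in> S \<Longrightarrow> b \<le> \<psi> x" "\<And>x. x \<in> S \<Longrightarrow> \<psi> x \<le> B" and "\<delta> > 0"
  obtains R' x where "R' \<ge> R" "x \<in> S" "norm x \<ge> 2 * R'"
    "\<And>y. y \<in> S \<Longrightarrow> norm y \<ge> R' \<Longrightarrow> \<psi> x \<le> \<psi> y + \<delta>"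
proof -
  define A where "A = (\<lambda>R. {x \<in> S. R \<le> norm x})"
  have A: "A R \<noteq> {}" for R
  proof -
    obtain x where "x \<in> S" "\<not> norm x \<le> R" using S unfolding bounded_iff by blast
    then have "x \<in> A R" by (simp add: A_def)
    then show ?thesis by blast
  qed
  define m where "m = (\<lambda>R. Inf (\<psi> ` A R))"
  have bdd: "bdd_below (\<psi> ` A R)" for R
    by (rule bdd_belowI[of _ b]) (auto simp: A_def \<psi>)
  have mB: "m R \<le> B" for R
  proof -
    obtain x where "x \<in> A R" using A by blast
    then have "m R \<le> \<psi> x" "\<psi> x \<le> B" unfolding m_def using bdd by (auto intro!: cInf_lower simp: A_def \<psi>)
    then show ?thesis by simp
  qed
  then have bddm: "bdd_above (range m)" by (intro bdd_aboveI[of _ B]) auto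
  define c where "c = Sup (range m)"
  have "c - \<delta> / 2 < Sup (range m)" using \<open>\<delta> > 0\<close> by (simp add: c_def)
  then obtain R1 where R1: "c - \<delta> / 2 < m R1"
    using less_cSupD[of "range m" "c - \<delta> / 2"] by blast
  define R' where "R' = max R R1"
  have "m (2 * R') \<le> c" unfolding c_def using bddm by (intro cSup_upper) auto
  then have "m (2 * R') < c + \<delta> / 2" using \<open>\<delta> > 0\<close> by simp
  then obtain x where x: "x \<in> A (2 * R')" "\<psi> x < c + \<delta> / 2"
    unfolding m_def using cInf_lessD[of "\<psi> ` A (2 * R')"] A by blast
  show thesis
  proof (rule that[of R' x])
    fix y assume "y \<in> S" "R' \<le> norm y"
    then have "m R1 \<le> \<psi> y"
      unfolding m_def by (intro cInf_lower bdd) (auto simp: A_def R'_def)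
    with x(2) R1 show "\<psi> x \<le> \<psi> y + \<delta>" by simp
  qed (use x in \<open>auto simp: A_def R'_def\<close>)
qed

text \<open>A real \<open>Inf\<close> is informative only on a nonempty set that is bounded below:
  the given data supply a member, and all members are norms.\<close>

lemma rabier_le:
  fixes f :: "real ^ 'n \<Rightarrow> real ^ 'm"
  assumes v: "\<forall>i. v i \<in> symmetric_subdifferential (\<lambda>z. f z $ i) x"
    and w: "w \<in> limiting_normal_cone x \<Omega>" and l: "l \<in> {0..}" "(\<Sum>i\<in>UNIV. l $ i) = 1"
  shows "0 \<le> rabier f \<Omega> x" and "rabier f \<Omega> x \<le> norm ((\<Sum>i\<in>UNIV. (l $ i) *\<^sub>R v i) + w)"
proof -
  let ?A = "{norm ((\<Sum>i\<in>UNIV. (l $ i) *\<^sub>R v i) + w) | (v :: 'm \<Rightarrow> real ^ 'n) w (l :: real ^ 'm).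
            (\<forall>i. v i \<in> symmetric_subdifferential (\<lambda>z. f z $ i) x) \<and>
            w \<in> limiting_normal_cone x \<Omega> \<and> l \<in> {0..} \<and> (\<Sum>i\<in>UNIV. l $ i) = 1}"
  have mem: "norm ((\<Sum>i\<in>UNIV. (l $ i) *\<^sub>R v i) + w) \<in> ?A"
    by (rule CollectI, intro exI conjI) (rule refl v w l)+
  have nonneg: "0 \<le> t" if "t \<in> ?A" for t
    using that by (elim CollectE exE conjE) simp
  show "0 \<le> rabier f \<Omega> x"
    unfolding rabier_def by (rule cInf_greatest[OF _ nonneg]) (use mem in blast)
  show "rabier f \<Omega> x \<le> norm ((\<Sum>i\<in>UNIV. (l $ i) *\<^sub>R v i) + w)"
    unfolding rabier_def by (rule cInf_lower[OF mem bdd_belowI[OF nonneg]])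
qed

text \<open>At the interior minimizer the \<open>l $ i\<close> sum to 1, so \<open>rabier\<close> is
  at most the norm of the penalty gradient, hence at most
  \<open>\<alpha> * d = 5 * \<delta> / d\<close>. Multiplying by \<open>norm x\<close>, which is at
  most \<open>3 / 2 * d\<close>, cancels \<open>d\<close>.\<close>

lemma exists_small_rabier:
  fixes f :: "real ^ 'n \<Rightarrow> real ^ 'm"
  assumes f: "locally_lipschitz f" and \<Omega>: "closed \<Omega>"
    and bdd: "bounded_section (f ` \<Omega>) ybar" and unb: "\<not> bounded {x \<in> \<Omega>. f x \<le> ybar}" and e: "e > 0"
  obtains x where "x \<in> \<Omega>" "f x \<le> ybar" "R \<le> norm x" "0 \<le> rabier f \<Omega> x" "norm x * rabier f \<Omega> x \<le> e"
proof -
  let ?S = "{x \<in> \<Omega>. f x \<le> ybar}"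
  define \<psi> where "\<psi> = excess f ybar"
  obtain a where a: "\<And>x. x \<in> ?S \<Longrightarrow> a \<le> f x"
    using bdd by (force simp: bounded_section_def lower_section_def)
  \<comment> \<open>\<open>undefined\<close> stands for some index: a single component bounds the
    maximum from below.\<close>
  have lower: "a $ undefined - ybar $ undefined \<le> \<psi> x" if "x \<in> ?S" for x
    using a[OF that] component_le_excess[of f x undefined ybar]
    by (auto simp: \<psi>_def less_eq_vec_def intro: order_trans[OF diff_right_mono])
  \<comment> \<open>Chosen so that the final bound \<open>15 / 2 * \<delta>\<close> is at most
    \<open>e\<close>.\<close>
  define \<delta> where "\<delta> = e / 8"
  have \<delta>: "\<delta> > 0" using e by (simp add: \<delta>_def)
  obtain R' p where R': "max R 1 \<le> R'" and p: "p \<in> ?S" "2 * R' \<le> norm p"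
    and far: "\<And>y. y \<in> ?S \<Longrightarrow> R' \<le> norm y \<Longrightarrow> \<psi> p \<le> \<psi> y + \<delta>"
    by (rule almost_minimizer_at_infinity[where B = 0 and R = "max R 1", OF unb lower _ \<delta>])
      (auto simp: \<psi>_def excess_nonpos_iff)
  define d where "d = norm p"
  have d: "d > 0" using R' p unfolding d_def by linarith
  \<comment> \<open>On the sphere of radius \<open>d / 2\<close> around \<open>p\<close> the penalty
    equals \<open>5 / 4 * \<delta>\<close>, more than the \<delta> by which \<psi> can fall below
    \<open>\<psi> p\<close>; so no minimizer lies there.\<close>
  define \<alpha> where "\<alpha> = 5 * \<delta> / d\<^sup>2"
  have \<alpha>: "\<alpha> > 0" using \<delta> d by (simp add: \<alpha>_def)
  let ?C = "\<Omega> \<inter> cball p (d / 2)"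
  have "\<exists>x\<in>?C. \<forall>y\<in>?C. \<psi> x + \<alpha> * (norm (x - p))\<^sup>2 \<le> \<psi> y + \<alpha> * (norm (y - p))\<^sup>2"
    unfolding \<psi>_def
    by (rule continuous_attains_inf)
      (use p d \<Omega> in \<open>auto intro!: continuous_intros continuous_on_excess[OF locally_lipschitz_continuous_on[OF f]] closed_Int_compact\<close>)
  then obtain x where x: "x \<in> ?C"
    and xmin: "\<And>y. y \<in> ?C \<Longrightarrow> \<psi> x + \<alpha> * (norm (x - p))\<^sup>2 \<le> \<psi> y + \<alpha> * (norm (y - p))\<^sup>2"
    by blast
  \<comment> \<open>The minimization ranges over \<Omega> only; comparison with \<open>p\<close>
    brings the minimizer back into the sublevel set.\<close>
  have xp: "\<psi> x + \<alpha> * (norm (x - p))\<^sup>2 \<le> \<psi> p" using xmin[of p] p d by simp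
  moreover have "\<psi> p \<le> 0" using p by (simp add: \<psi>_def excess_nonpos_iff)
  moreover have "0 \<le> \<alpha> * (norm (x - p))\<^sup>2" using \<alpha> by simp
  ultimately have "\<psi> x \<le> 0" by linarith
  then have xS: "x \<in> ?S" using x by (simp add: \<psi>_def excess_nonpos_iff)
  have xd: "norm (x - p) \<le> d / 2" using x by (simp add: dist_norm norm_minus_commute)
  have nx: "norm x \<ge> R'" "norm x \<le> 3 / 2 * d"
    using norm_triangle_ineq2[of p x] norm_triangle_ineq2[of x p] xd p by (auto simp: d_def norm_minus_commute)
  have "norm (x - p) \<noteq> d / 2"
  proof
    assume eq: "norm (x - p) = d / 2"
    have "\<alpha> * (norm (x - p))\<^sup>2 = 5 / 4 * \<delta>"
      unfolding eq using d by (simp add: \<alpha>_def power2_eq_square)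
    with xp far[OF xS nx(1)] \<delta> show False by simp
  qed
  with xd have \<rho>: "d / 2 - norm (x - p) > 0" by simp
  have g: "((\<lambda>y. \<alpha> * (norm (y - p))\<^sup>2) has_derivative (\<lambda>h. inner (\<alpha> *\<^sub>R 2 *\<^sub>R (y - p)) h)) (at y)" for y
    using has_derivative_mult_right[OF square_norm_derivative, of \<alpha> p y] by (simp add: mult.assoc)
  have Gc: "continuous_on UNIV (\<lambda>y. \<alpha> *\<^sub>R 2 *\<^sub>R (y - p))" by (intro continuous_intros)
  \<comment> \<open>The identically zero constraint function yields \<open>\<mu> = 0\<close>, so the
    \<open>l $ i\<close> alone sum to 1.\<close>
  have H: "((\<lambda>y. 0 :: real) has_derivative (\<lambda>h. inner 0 h)) (at y)" for y :: "real ^ 'n" by simp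
  have m: "\<forall>y \<in> \<Omega> \<inter> cball x (d / 2 - norm (x - p)). (0 :: real) = 0 \<longrightarrow>
      excess f ybar x + \<alpha> * (norm (x - p))\<^sup>2 \<le> excess f ybar y + \<alpha> * (norm (y - p))\<^sup>2"
  proof (intro ballI impI)
    fix y assume y: "y \<in> \<Omega> \<inter> cball x (d / 2 - norm (x - p))"
    then have "dist p y \<le> d / 2"
      using dist_triangle[of p y x] by (simp add: dist_norm norm_minus_commute)
    then show "excess f ybar x + \<alpha> * (norm (x - p))\<^sup>2 \<le> excess f ybar y + \<alpha> * (norm (y - p))\<^sup>2"
      using xmin[of y] y by (simp add: \<psi>_def)
  qed
  have x\<Omega>: "x \<in> \<Omega>" using x by simp
  obtain v and l :: "real ^ 'm" and \<mu> w
    where vl: "\<forall>i. v i \<in> symmetric_subdifferential (\<lambda>z. f z $ i) x" "l \<in> {0..}"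
      and sum: "(\<Sum>i\<in>UNIV. l $ i) + \<bar>\<mu>\<bar> = 1" and w: "w \<in> limiting_normal_cone x \<Omega>"
      and eq: "(\<Sum>i\<in>UNIV. l $ i *\<^sub>R v i) + (\<Sum>i\<in>UNIV. l $ i) *\<^sub>R \<alpha> *\<^sub>R 2 *\<^sub>R (x - p) + \<mu> *\<^sub>R 0 + w = 0"
      and \<mu>: "(\<forall>y :: real ^ 'n. (0 :: real) = 0) \<longrightarrow> \<mu> = 0"
    by (rule excess_multiplier_rule[OF f \<Omega> x\<Omega> \<rho> g Gc H continuous_on_const refl m]) blast
  from \<mu> sum have sum1: "(\<Sum>i\<in>UNIV. l $ i) = 1" by simp
  note r = rabier_le[OF vl(1) w vl(2) sum1]
  have "(\<Sum>i\<in>UNIV. l $ i *\<^sub>R v i) + w = - (\<alpha> *\<^sub>R 2 *\<^sub>R (x - p))"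
    using eq sum1 by (simp add: eq_neg_iff_add_eq_0 algebra_simps)
  then have "norm ((\<Sum>i\<in>UNIV. l $ i *\<^sub>R v i) + w) = \<alpha> * (2 * norm (x - p))"
    using \<alpha> by simp
  also have "\<dots> \<le> \<alpha> * d" using xd \<alpha> by (intro mult_left_mono) auto
  finally have "rabier f \<Omega> x \<le> \<alpha> * d" using r(2) by linarith
  then have "norm x * rabier f \<Omega> x \<le> (3 / 2 * d) * (\<alpha> * d)"
    using nx r(1) d by (intro mult_mono) auto
  also have "\<dots> = 15 / 2 * \<delta>" using d by (simp add: \<alpha>_def power2_eq_square)
  also have "\<dots> \<le> e" using e by (simp add: \<delta>_def)
  finally show thesis
    using that[of x] xS nx(1) R' r(1) by auto
qed

text \<open>Over \<Omega> and the sphere through \<open>p\<close> the least excess is nonpositive,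
  as it is at \<open>p\<close>. With \<open>g = 0\<close> and the sphere written as
  \<open>H = 0\<close>, the multiplier rule becomes the defining condition of
  \<open>Gamma_set\<close>.\<close>

lemma exists_Gamma_set:
  fixes f :: "real ^ 'n \<Rightarrow> real ^ 'm"
  assumes f: "locally_lipschitz f" and \<Omega>: "closed \<Omega>" and unb: "\<not> bounded {x \<in> \<Omega>. f x \<le> ybar}"
  obtains x where "x \<in> Gamma_set f \<Omega>" "f x \<le> ybar" "R \<le> norm x"
proof -
  obtain p where p: "p \<in> \<Omega>" "f p \<le> ybar" "R < norm p"
    using unb unfolding bounded_iff by (auto simp: not_le)
  let ?C = "\<Omega> \<inter> sphere 0 (norm p)"
  have "\<exists>x\<in>?C. \<forall>y\<in>?C. excess f ybar x \<le> excess f ybar y"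
    by (rule continuous_attains_inf)
      (use p \<Omega> in \<open>auto intro!: continuous_on_excess[OF locally_lipschitz_continuous_on[OF f]] closed_Int_compact\<close>)
  then obtain x where x: "x \<in> ?C" and xmin: "\<And>y. y \<in> ?C \<Longrightarrow> excess f ybar x \<le> excess f ybar y"
    by blast
  have "excess f ybar x \<le> 0"
    using xmin[of p] p excess_nonpos_iff[of f ybar p] by simp
  then have fx: "f x \<le> ybar" by (simp add: excess_nonpos_iff)
  have g: "((\<lambda>y. 0 :: real) has_derivative (\<lambda>h. inner 0 h)) (at y)" for y :: "real ^ 'n" by simp
  \<comment> \<open>Half the squared norm has gradient \<open>y\<close>, so \<mu> multiplies
    \<open>x\<close> itself.\<close>
  have H: "((\<lambda>y. ((norm y)\<^sup>2 - (norm p)\<^sup>2) / 2) has_derivative (\<lambda>h. inner y h)) (at y)" for y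
    using square_norm_derivative[of 0 y UNIV] by (auto intro!: derivative_eq_intros)
  have H0: "((norm x)\<^sup>2 - (norm p)\<^sup>2) / 2 = 0" using x by simp
  \<comment> \<open>The equation confines the comparison to the sphere, where \<open>x\<close> is a
    global minimizer over \<Omega>; the radius 1 is arbitrary.\<close>
  have m: "\<forall>y \<in> \<Omega> \<inter> cball x 1. ((norm y)\<^sup>2 - (norm p)\<^sup>2) / 2 = 0 \<longrightarrow>
      excess f ybar x + 0 \<le> excess f ybar y + 0"
    using xmin by simp
  have x\<Omega>: "x \<in> \<Omega>" using x by simp
  obtain v and l :: "real ^ 'm" and \<mu> w
    where v: "\<forall>i. v i \<in> symmetric_subdifferential (\<lambda>z. f z $ i) x" and l: "l \<in> {0..}"
      "(\<Sum>i\<in>UNIV. l $ i) + \<bar>\<mu>\<bar> = 1" and w: "w \<in> limiting_normal_cone x \<Omega>"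
      and eq: "(\<Sum>i\<in>UNIV. l $ i *\<^sub>R v i) + (\<Sum>i\<in>UNIV. l $ i) *\<^sub>R 0 + \<mu> *\<^sub>R x + w = 0"
    by (rule excess_multiplier_rule[OF f \<Omega> x\<Omega> zero_less_one g continuous_on_const H continuous_on_id H0 m])
      blast
  from eq have "0 = (\<Sum>i\<in>UNIV. l $ i *\<^sub>R v i) + \<mu> *\<^sub>R x + w" by simp
  with v l w x have "x \<in> Gamma_set f \<Omega>"
    unfolding Gamma_set_def by blast
  then show thesis using that fx x p by simp
qed

section \<open>Compactness of order intervals and properness\<close>

lemma bounded_section_convergent_subseq:
  assumes "bounded_section (f ` \<Omega>) ybar" "\<And>k. x k \<in> \<Omega>" "\<And>k. f (x k) \<le> ybar"
  obtains r :: "nat \<Rightarrow> nat" and y where "strict_mono r" "(\<lambda>k. f (x (r k))) \<longlonglongrightarrow> y"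
proof -
  obtain a where "lower_section (f ` \<Omega>) ybar \<subseteq> {a..}"
    using assms(1) by (auto simp: bounded_section_def)
  then have "f (x k) \<in> {a..ybar}" for k
    using assms(2,3) by (force simp: lower_section_def)
  moreover have "compact {a..ybar}" by (rule compact_interval)
  ultimately show thesis
    using that unfolding compact_def o_def by meson
qed

lemma bounded_not_norm_at_top:
  assumes "bounded S" "\<And>k :: nat. x k \<in> S" "filterlim (\<lambda>k. norm (x k)) at_top sequentially"
  shows False
proof -
  obtain b where "\<And>k. norm (x k) \<le> b"
    using assms(1,2) unfolding bounded_iff by blast
  moreover obtain k where "b < norm (x k)"
    using filterlim_at_top_dense[THEN iffD1, OF assms(3)] unfolding eventually_sequentially by blast
  ultimately show False by (simp add: leD)
qed

text \<open>A sequence escaping to infinity in this set has a subsequence along which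
  \<open>f\<close> converges, against properness. If the set is bounded, there is no such sequence
  and properness holds vacuously.\<close>

lemma proper_at_sublevel_iff_bounded:
  fixes f :: "real ^ 'n \<Rightarrow> real ^ 'm"
  assumes "bounded_section (f ` \<Omega>) ybar"
  shows "proper_at_sublevel f \<Omega> ybar \<longleftrightarrow> bounded {x \<in> \<Omega>. f x \<le> ybar}"
proof
  assume proper: "proper_at_sublevel f \<Omega> ybar"
  show "bounded {x \<in> \<Omega>. f x \<le> ybar}"
  proof (rule ccontr)
    assume "\<not> bounded {x \<in> \<Omega>. f x \<le> ybar}"
    then have "\<exists>x. x \<in> \<Omega> \<and> f x \<le> ybar \<and> real k < norm x" for k
      unfolding bounded_iff by (auto simp: not_le)
    then obtain x where x: "\<And>k. x k \<in> \<Omega>" "\<And>k. f (x k) \<le> ybar" "\<And>k. real k < norm (x k)" by metis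
    have "filterlim (\<lambda>k. norm (x k)) at_top sequentially"
      by (rule filterlim_at_top_mono[OF filterlim_real_sequentially]) (use x in \<open>auto simp: less_imp_le\<close>)
    with proper x have top: "filterlim (\<lambda>k. norm (f (x k))) at_top sequentially"
      unfolding proper_at_sublevel_def by blast
    obtain r :: "nat \<Rightarrow> nat" and y where r: "strict_mono r" "(\<lambda>k. f (x (r k))) \<longlonglongrightarrow> y"
      using bounded_section_convergent_subseq[where x = x and f = f, OF assms x(1,2)] by blast
    have "filterlim (\<lambda>k. norm (f (x (r k)))) at_top sequentially"
      by (rule filterlim_compose[OF top filterlim_subseq[OF r(1)]])
    then show False
      using tendsto_norm[OF r(2)] not_tendsto_and_filterlim_at_infinity[OF sequentially_bot]
        filterlim_at_top_imp_at_infinity by blast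
  qed
next
  assume "bounded {x \<in> \<Omega>. f x \<le> ybar}"
  then show "proper_at_sublevel f \<Omega> ybar"
    unfolding proper_at_sublevel_def using bounded_not_norm_at_top by fastforce
qed

section \<open>The equivalences and compactness of the section\<close>

theorem theorem3p1:
  fixes f :: "real ^ 'n \<Rightarrow> real ^ 'm"
    and \<Omega> :: "(real ^ 'n) set"
    and ybar :: "real ^ 'm"
  assumes "locally_lipschitz f"
    and "\<Omega> \<noteq> {}"
    and "closed \<Omega>"
    and "ybar \<in> f ` \<Omega>"
    and "bounded_section (f ` \<Omega>) ybar"
  shows "(proper_at_sublevel f \<Omega> ybar \<longleftrightarrow> palais_smale f \<Omega> ybar) \<and>
         (palais_smale f \<Omega> ybar \<longleftrightarrow> weak_palais_smale f \<Omega> ybar) \<and>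
         (weak_palais_smale f \<Omega> ybar \<longleftrightarrow> M_tame f \<Omega> ybar) \<and>
         (proper_at_sublevel f \<Omega> ybar \<or> palais_smale f \<Omega> ybar \<or>
            weak_palais_smale f \<Omega> ybar \<or> M_tame f \<Omega> ybar \<longrightarrow>
          lower_section (f ` \<Omega>) ybar \<noteq> {} \<and> compact (lower_section (f ` \<Omega>) ybar))"
proof -
  note f = assms(1) and \<Omega> = assms(3) and bdd = assms(5)
  let ?S = "{x \<in> \<Omega>. f x \<le> ybar}"
  have proper: "proper_at_sublevel f \<Omega> ybar \<longleftrightarrow> bounded ?S"
    using bdd by (rule proper_at_sublevel_iff_bounded)
  have empty: "Ktilde_inf f \<Omega> ybar = {}" "T_inf f \<Omega> ybar = {}" if "bounded ?S"
    using bounded_not_norm_at_top[OF that]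
    by (auto simp: Ktilde_inf_def T_inf_def Gamma_set_def)
  \<comment> \<open>Eventually \<open>norm (x k)\<close> is at least 1, so the weighted condition is
    the stronger one. Thus a point of \<open>K_inf\<close> refutes both Palais-Smale conditions, and
    emptiness of \<open>Ktilde_inf\<close> gives both.\<close>
  have "K_inf f \<Omega> ybar \<subseteq> Ktilde_inf f \<Omega> ybar"
    unfolding K_inf_def Ktilde_inf_def
  proof safe
    fix y x
    assume x: "\<forall>k. x k \<in> \<Omega>" "\<forall>k. f (x k) \<le> ybar" "filterlim (\<lambda>k. norm (x k)) at_top sequentially"
      "(\<lambda>k. f (x k)) \<longlonglongrightarrow> y" "(\<lambda>k. norm (x k) * rabier f \<Omega> (x k)) \<longlonglongrightarrow> 0"
    have "\<forall>\<^sub>F k in sequentially. 1 \<le> norm (x k)"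
      using x(3) by (simp add: filterlim_at_top)
    then have "\<forall>\<^sub>F k in sequentially. norm (rabier f \<Omega> (x k)) \<le> \<bar>norm (x k) * rabier f \<Omega> (x k)\<bar>"
    proof eventually_elim
      case (elim k)
      then show ?case
        using mult_right_mono[of 1 "norm (x k)" "\<bar>rabier f \<Omega> (x k)\<bar>"] by (simp add: abs_mult)
    qed
    then have "(\<lambda>k. rabier f \<Omega> (x k)) \<longlonglongrightarrow> 0"
      by (rule Lim_null_comparison) (rule tendsto_rabs_zero[OF x(5)])
    with x show "\<exists>x. (\<forall>k. x k \<in> \<Omega>) \<and> (\<forall>k. f (x k) \<le> ybar) \<and>
        filterlim (\<lambda>k. norm (x k)) at_top sequentially \<and>
        (\<lambda>k. f (x k)) \<longlonglongrightarrow> y \<and> (\<lambda>k. rabier f \<Omega> (x k)) \<longlonglongrightarrow> 0"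
      by blast
  qed
  moreover have "K_inf f \<Omega> ybar \<noteq> {}" if unb: "\<not> bounded ?S"
  proof -
    \<comment> \<open>Tolerance \<open>1 / (k + 1)\<close> at distance at least \<open>k\<close>;
      passing to a subsequence makes the values of \<open>f\<close> converge as well.\<close>
    have "\<exists>x. x \<in> \<Omega> \<and> f x \<le> ybar \<and> real k \<le> norm x \<and> 0 \<le> rabier f \<Omega> x \<and>
        norm x * rabier f \<Omega> x \<le> inverse (real (Suc k))" for k
      by (rule exists_small_rabier[OF f \<Omega> bdd unb, of "inverse (real (Suc k))" "real k"]) auto
    then obtain x where x: "\<And>k. x k \<in> \<Omega>" "\<And>k. f (x k) \<le> ybar" "\<And>k. real k \<le> norm (x k)"
        "\<And>k. 0 \<le> rabier f \<Omega> (x k)" "\<And>k. norm (x k) * rabier f \<Omega> (x k) \<le> inverse (real (Suc k))"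
      by metis
    have top: "filterlim (\<lambda>k. norm (x k)) at_top sequentially"
      by (rule filterlim_at_top_mono[OF filterlim_real_sequentially]) (use x in auto)
    have null: "(\<lambda>k. norm (x k) * rabier f \<Omega> (x k)) \<longlonglongrightarrow> 0"
      by (rule tendsto_sandwich[OF _ _ tendsto_const LIMSEQ_inverse_real_of_nat])
        (use x in \<open>auto intro!: always_eventually mult_nonneg_nonneg simp del: of_nat_Suc\<close>)
    obtain r :: "nat \<Rightarrow> nat" and y where r: "strict_mono r" "(\<lambda>k. f (x (r k))) \<longlonglongrightarrow> y"
      using bounded_section_convergent_subseq[where x = x and f = f, OF bdd x(1,2)] by blast
    have "y \<in> K_inf f \<Omega> ybar"
      unfolding K_inf_def
      by (intro CollectI exI[of _ "\<lambda>k. x (r k)"])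
        (use x r(2) filterlim_compose[OF top filterlim_subseq[OF r(1)]]
          LIMSEQ_subseq_LIMSEQ[OF null r(1)] in \<open>simp add: o_def\<close>)
    then show ?thesis by blast
  qed
  moreover have "T_inf f \<Omega> ybar \<noteq> {}" if unb: "\<not> bounded ?S"
  proof -
    have "\<exists>x. x \<in> Gamma_set f \<Omega> \<and> f x \<le> ybar \<and> real k \<le> norm x" for k
      by (rule exists_Gamma_set[OF f \<Omega> unb, of "real k"]) auto
    then obtain x where x: "\<And>k. x k \<in> Gamma_set f \<Omega>" "\<And>k. f (x k) \<le> ybar" "\<And>k. real k \<le> norm (x k)"
      by metis
    have top: "filterlim (\<lambda>k. norm (x k)) at_top sequentially"
      by (rule filterlim_at_top_mono[OF filterlim_real_sequentially]) (use x in auto)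
    have "x k \<in> \<Omega>" for k using x(1)[of k] by (simp add: Gamma_set_def)
    then obtain r :: "nat \<Rightarrow> nat" and y where r: "strict_mono r" "(\<lambda>k. f (x (r k))) \<longlonglongrightarrow> y"
      using bounded_section_convergent_subseq[where x = x and f = f, OF bdd _ x(2)] by blast
    have "y \<in> T_inf f \<Omega> ybar"
      unfolding T_inf_def
      by (intro CollectI exI[of _ "\<lambda>k. x (r k)"])
        (use x r(2) filterlim_compose[OF top filterlim_subseq[OF r(1)]] in simp)
    then show ?thesis by blast
  qed
  ultimately have iff: "palais_smale f \<Omega> ybar \<longleftrightarrow> bounded ?S" "weak_palais_smale f \<Omega> ybar \<longleftrightarrow> bounded ?S"
    "M_tame f \<Omega> ybar \<longleftrightarrow> bounded ?S"
    using empty unfolding palais_smale_def weak_palais_smale_def M_tame_def by blast+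
  have section_eq: "lower_section (f ` \<Omega>) ybar = f ` ?S"
    by (auto simp: lower_section_def)
  have "compact (f ` ?S)" if "bounded ?S"
  proof -
    have "closed (\<Omega> \<inter> f -` {..ybar})"
      by (rule continuous_closed_preimage[OF locally_lipschitz_continuous_on[OF f] \<Omega>]) (rule closed_eucl_atMost)
    moreover have "\<Omega> \<inter> f -` {..ybar} = ?S" by auto
    ultimately show ?thesis
      using that f by (intro compact_continuous_image locally_lipschitz_continuous_on)
        (simp_all add: compact_eq_bounded_closed)
  qed
  moreover have "f ` ?S \<noteq> {}" using assms(4) by auto
  ultimately show ?thesis
    unfolding proper iff section_eq by blast
qed

end
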